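(* Let $V$ be a finite-dimensional vector space over a field of characteristic zero, let $s\ge 1$, and let $P\in\Lambda^s V$ be an $s$-vector. Then $P$ is decomposable if and only if one of the following conditions holds (that is, each one of these conditions is, by itself, equivalent to the decomposability of $P$): (1) $(i(\Phi)P)\wedge P=0$ for all $\Phi\in\Lambda^{s-1}V^*$. In index notation, $P_{[abc\cdots d}P_{e]fg\cdots h}=0$, where the skew-symmetrization is over $s+1$ indices, namely all $s$ indices of the first factor and one index of the second. (2) $i(i_P\Psi)P=0$ for all $\Psi\in\Lambda^{s+1}V^*$. (3) $i_{\alpha_1\wedge\cdots\wedge\alpha_{s-k}}P$ is decomposable for all $\alpha_1,\dots,\alpha_{s-k}\in V^*$, for any fixed $k\ge 2$ (that is, for each fixed integer $k$ with $2\le k\le s$, this condition for that single $k$ is equivalent to decomposability of $P$). (4) $(i(\Psi)P)\wedge P=0$ for all $\Psi\in\Lambda^{s-2}V^*$. In index notation (when $s\ge 2$), $P_{[abc\cdots d}P_{ef]g\cdots h}=0$, where the skew-symmetrization is over $s+2$ indices, namely all $s$ indices of the first factor and two indices of the second. (5) $i(i_P\Psi)P=0$ for all $\Psi\in\Lambda^{s+2}V^*$.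
   Context: An $s$-vector $P\in\Lambda^sV$ is called decomposable (or simple) if it can be written as $P=u\wedge v\wedge\cdots\wedge w$ with $s$ vectors $u,v,\dots,w\in V$ (so $P=0$ is decomposable). Exterior powers of negative degree are zero. $\langle\cdot,\cdot\rangle$ is the natural duality pairing between $\Lambda^pV$ and $\Lambda^pV^*$. For $\Phi\in\Lambda^pV^*$ and $P\in\Lambda^sV$ with $p\le s$, the contraction $i(\Phi)P=i_\Phi P\in\Lambda^{s-p}V$ is defined by $\langle i(\Phi)P,\Theta\rangle=\langle P,\Phi\wedge\Theta\rangle$ for all $\Theta\in\Lambda^{s-p}V^*$. Dually, for $P\in\Lambda^sV$ and $\Psi\in\Lambda^{q}V^*$ with $s\le q$, the contraction $i_P\Psi\in\Lambda^{q-s}V^*$ is defined by $\langle Q,i_P\Psi\rangle=\langle P\wedge Q,\Psi\rangle$ for all $Q\in\Lambda^{q-s}V$. Contractions that would land in a negative degree are zero. For $k=s$ in (3), the empty wedge product is $1$ and the contraction is $P$ itself. In index notation, $P_{ab\cdots d}$ denotes $P$ regarded as a totally skew tensor with $s$ indices, juxtaposition denotes the tensor product, and square brackets denote total skew-symmetrization over the enclosed indices. *)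

theory Defs
  imports Complex_Main "HOL-Library.Function_Algebras" "HOL-Combinatorics.Permutations"
begin

text \<open>
  Exterior algebra of a finite-dimensional vector space \<open>V\<close> over a field of characteristic zero.
  \<open>V\<close> is the whole type \<open>'v\<close> with scalar multiplication \<open>scale\<close>; its dual \<open>V*\<close> is the set
  \<open>dual_space scale\<close> of linear functionals, with pointwise operations. An \<open>s\<close>-vector is modelled
  as a totally skew contravariant tensor, that is, as an alternating multilinear function of \<open>s\<close>
  covectors, and a \<open>p\<close>-form as an alternating multilinear function of \<open>p\<close> vectors. The arguments
  are passed as a list, and the function is zero on every other list.
\<close>

definition dual_space :: "('k::field \<Rightarrow> 'v::ab_group_add \<Rightarrow> 'v) \<Rightarrow> ('v \<Rightarrow> 'k) set" where
  "dual_space scale = {\<alpha>. Vector_Spaces.linear scale (*) \<alpha>}"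

text \<open>
  The degree \<open>d\<close> is an integer: for \<open>d < 0\<close> no list has length \<open>d\<close>, so only the zero function
  qualifies, as required of exterior powers of negative degree. For \<open>d = 0\<close> the functions are the
  scalars, stored as the value at the empty list.
\<close>

definition alternating ::
    "('k::field \<Rightarrow> 'a::ab_group_add \<Rightarrow> 'a) \<Rightarrow> 'a set \<Rightarrow> int \<Rightarrow> ('a list \<Rightarrow> 'k) set" where
  "alternating sc S d =
    {F. (\<forall>xs. int (length xs) \<noteq> d \<or> \<not> set xs \<subseteq> S \<longrightarrow> F xs = 0) \<and>
        (\<forall>xs i. int (length xs) = d \<and> set xs \<subseteq> S \<and> i < length xs \<longrightarrow>
           (\<forall>x\<in>S. \<forall>y\<in>S. F (xs[i := x + y]) = F (xs[i := x]) + F (xs[i := y])) \<and>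
           (\<forall>c. \<forall>x\<in>S. F (xs[i := sc c x]) = c * F (xs[i := x]))) \<and>
        (\<forall>xs. \<not> distinct xs \<longrightarrow> F xs = 0)}"

definition multivectors ::
    "('k::field \<Rightarrow> 'v::ab_group_add \<Rightarrow> 'v) \<Rightarrow> int \<Rightarrow> (('v \<Rightarrow> 'k) list \<Rightarrow> 'k) set" where
  "multivectors scale = alternating (\<lambda>c \<alpha> v. c * \<alpha> v) (dual_space scale)"

definition forms ::
    "('k::field \<Rightarrow> 'v::ab_group_add \<Rightarrow> 'v) \<Rightarrow> int \<Rightarrow> ('v list \<Rightarrow> 'k) set" where
  "forms scale = alternating scale UNIV"

text \<open>
  The exterior product as a sum over shuffles: \<open>A\<close> is the set of positions whose arguments go to
  the first factor, and the sign is that of the permutation moving these positions to the front.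
  For \<open>F\<close> and \<open>G\<close> of degrees \<open>p\<close> and \<open>q\<close> this is \<open>1/(p! q!)\<close> times the signed sum over all
  permutations of the \<open>p + q\<close> arguments, so that
  \<open>(u \<and> v)(\<alpha>, \<beta>) = \<alpha>(u) \<beta>(v) - \<beta>(u) \<alpha>(v)\<close>.
\<close>

definition wedge :: "('a list \<Rightarrow> 'k::field) \<Rightarrow> ('a list \<Rightarrow> 'k) \<Rightarrow> 'a list \<Rightarrow> 'k"
    (infixr \<open>\<and>\<^sub>e\<close> 72) where
  "F \<and>\<^sub>e G = (\<lambda>xs. \<Sum>A\<in>Pow {..<length xs}.
     (-1) ^ card {(i, j). i \<in> A \<and> j \<in> {..<length xs} - A \<and> j < i} *
     F (nths xs A) * G (nths xs ({..<length xs} - A)))"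

definition wedge_list :: "('a list \<Rightarrow> 'k::field) list \<Rightarrow> 'a list \<Rightarrow> 'k" where
  "wedge_list Fs = foldr (\<and>\<^sub>e) Fs (\<lambda>xs. if xs = [] then 1 else 0)"

text \<open>Vectors as \<open>1\<close>-vectors and covectors as \<open>1\<close>-forms.\<close>

definition of_vector ::
    "('k::field \<Rightarrow> 'v::ab_group_add \<Rightarrow> 'v) \<Rightarrow> 'v \<Rightarrow> ('v \<Rightarrow> 'k) list \<Rightarrow> 'k" where
  "of_vector scale v = (\<lambda>\<alpha>s. case \<alpha>s of [\<alpha>] \<Rightarrow> if \<alpha> \<in> dual_space scale then \<alpha> v else 0 | _ \<Rightarrow> 0)"

definition of_covector :: "('v \<Rightarrow> 'k::field) \<Rightarrow> 'v list \<Rightarrow> 'k" where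
  "of_covector \<alpha> = (\<lambda>vs. case vs of [v] \<Rightarrow> \<alpha> v | _ \<Rightarrow> 0)"

definition decomposable ::
    "('k::field \<Rightarrow> 'v::ab_group_add \<Rightarrow> 'v) \<Rightarrow> nat \<Rightarrow> (('v \<Rightarrow> 'k) list \<Rightarrow> 'k) \<Rightarrow> bool" where
  "decomposable scale s P \<longleftrightarrow>
    (\<exists>vs. length vs = s \<and> P = wedge_list (map (of_vector scale) vs))"

text \<open>
  The duality pairing of multivectors and forms of the same degree \<open>p\<close>: the full contraction of
  the two tensors divided by \<open>p!\<close>, computed in a basis \<open>B\<close> and its dual basis; the terms with a
  repeated basis vector vanish and are omitted. The value does not depend on \<open>B\<close>, and the
  normalisation is the one with
  \<open>\<langle>u\<^sub>1 \<and> \<dots> \<and> u\<^sub>p, \<alpha>\<^sub>1 \<and> \<dots> \<and> \<alpha>\<^sub>p\<rangle> = det (\<alpha>\<^sub>i(u\<^sub>j))\<close>.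
\<close>

definition pairing ::
    "('k::field_char_0 \<Rightarrow> 'v::ab_group_add \<Rightarrow> 'v) \<Rightarrow> 'v set \<Rightarrow>
      (('v \<Rightarrow> 'k) list \<Rightarrow> 'k) \<Rightarrow> ('v list \<Rightarrow> 'k) \<Rightarrow> 'k" where
  "pairing scale B P \<Phi> =
    (\<Sum>bs | distinct bs \<and> set bs \<subseteq> B.
       P (map (\<lambda>b v. module.representation scale B v b) bs) * \<Phi> bs / fact (length bs))"

text \<open>
  \<open>contract_vec scale B p s \<Phi> P\<close> is \<open>i(\<Phi>)P\<close> for a \<open>p\<close>-form \<open>\<Phi>\<close> and an \<open>s\<close>-vector \<open>P\<close>;
  \<open>contract_form scale B s q P \<Psi>\<close> is \<open>i\<^sub>P\<Psi>\<close> for an \<open>s\<close>-vector \<open>P\<close> and a \<open>q\<close>-form \<open>\<Psi>\<close>.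
  Both are zero when the resulting degree is negative, by the convention on negative degrees.
\<close>

definition contract_vec ::
    "('k::field_char_0 \<Rightarrow> 'v::ab_group_add \<Rightarrow> 'v) \<Rightarrow> 'v set \<Rightarrow> int \<Rightarrow> int \<Rightarrow>
      ('v list \<Rightarrow> 'k) \<Rightarrow> (('v \<Rightarrow> 'k) list \<Rightarrow> 'k) \<Rightarrow> ('v \<Rightarrow> 'k) list \<Rightarrow> 'k" where
  "contract_vec scale B p s \<Phi> P =
    (THE R. R \<in> multivectors scale (s - p) \<and>
       (\<forall>\<Theta>\<in>forms scale (s - p). pairing scale B R \<Theta> = pairing scale B P (\<Phi> \<and>\<^sub>e \<Theta>)))"

definition contract_form ::
    "('k::field_char_0 \<Rightarrow> 'v::ab_group_add \<Rightarrow> 'v) \<Rightarrow> 'v set \<Rightarrow> int \<Rightarrow> int \<Rightarrow>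
      (('v \<Rightarrow> 'k) list \<Rightarrow> 'k) \<Rightarrow> ('v list \<Rightarrow> 'k) \<Rightarrow> 'v list \<Rightarrow> 'k" where
  "contract_form scale B s q P \<Psi> =
    (THE \<Omega>. \<Omega> \<in> forms scale (q - s) \<and>
       (\<forall>Q\<in>multivectors scale (q - s). pairing scale B Q \<Omega> = pairing scale B (P \<and>\<^sub>e Q) \<Psi>))"

text \<open>
  Index notation: the tensor product (the first factor having \<open>s\<close> indices) and the
  skew-symmetrization over the first \<open>m\<close> indices.
\<close>

definition tensor :: "nat \<Rightarrow> ('a list \<Rightarrow> 'k::field) \<Rightarrow> ('a list \<Rightarrow> 'k) \<Rightarrow> 'a list \<Rightarrow> 'k" where
  "tensor s F G = (\<lambda>xs. F (take s xs) * G (drop s xs))"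

definition skew :: "nat \<Rightarrow> ('a list \<Rightarrow> 'k::field_char_0) \<Rightarrow> 'a list \<Rightarrow> 'k" where
  "skew m T = (\<lambda>xs. (\<Sum>\<pi> | \<pi> permutes {..<m}.
     of_int (sign \<pi>) * T (map (\<lambda>i. xs ! \<pi> i) [0..<length xs])) / fact m)"

end

theory Submission
  imports Defs
begin

text \<open>
  All conditions are compared with the three-term relations
  \<open>Q(a,b) Q(c,d) - Q(a,c) Q(b,d) + Q(a,d) Q(b,c) = 0\<close> for the \<open>2\<close>-vectors \<open>Q = i\<^sub>\<gamma> P\<close>, where \<open>\<gamma>\<close>
  runs through the lists of \<open>s - 2\<close> covectors. Evaluating \<open>(i\<^sub>\<gamma> P) \<and> P\<close> on \<open>\<gamma>\<close> followed by four
  covectors gives \<open>Q \<and> Q\<close>, and \<open>Q \<and> Q = 0\<close> is the three-term relation. Conversely, let \<open>P(\<alpha>) = 1\<close>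
  for some \<open>\<alpha> = (\<alpha>\<^sub>1, \<dots>, \<alpha>\<^sub>s)\<close>, let \<open>u\<^sub>i\<close> be the vector \<open>\<beta> \<mapsto> P(\<dots>, \<beta>, \<dots>)\<close> with \<open>\<beta>\<close> in place of
  \<open>\<alpha>\<^sub>i\<close>, and let \<open>W\<close> be the common annihilator of the \<open>u\<^sub>i\<close>. The relations force \<open>P\<close> to vanish as soon
  as one of its arguments is in \<open>W\<close>, and therefore \<open>P = u\<^sub>1 \<and> \<dots> \<and> u\<^sub>s\<close>. Conditions (2) and (5) are
  the adjoints of (1) and (4).
\<close>

subsection \<open>Interior multiplication and the wedge product\<close>

text \<open>That decomposability implies the relations is a matter of counting: each factor
  \<open>u\<close> of \<open>P\<close> annihilates \<open>P\<close> under the wedge product, and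
  fewer than \<open>s\<close> insertions of covectors leave some factor in every term. The converse
  has one real obstacle. A single entry from \<open>W\<close> kills \<open>P\<close> by definition,
  but for several such entries this is not visible, and once more than two slots are involved, the
  three-term relation with the other entries taken from \<open>W\<close> itself is void: its leading
  coefficient vanishes by induction. Entries \<open>w i + \<alpha> i\<close> repair this. The values
  at the \<open>\<alpha> i\<close> and at \<open>W\<close> then determine \<open>P\<close>, since
  together these span the covectors. Characteristic zero enters through the wedge square of
  \<open>Q\<close>, which is twice the three-term expression, and through the factorials in the
  pairing. Contractions are specified only by their pairings, so they have to be computed; all of
  them reduce to inserting covectors as leading arguments, for which the wedge product obeys a
  Leibniz rule.\<close>

definition interior :: "'a \<Rightarrow> ('a list \<Rightarrow> 'k) \<Rightarrow> 'a list \<Rightarrow> 'k" where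
  "interior x F = (\<lambda>xs. F (x # xs))"

definition interiors :: "'a list \<Rightarrow> ('a list \<Rightarrow> 'k) \<Rightarrow> 'a list \<Rightarrow> 'k" where
  "interiors ys F = (\<lambda>xs. F (ys @ xs))"

text \<open>The grade involution. It carries the sign of moving an interior multiplication past a
  first factor without naming a degree.\<close>

definition twist :: "('a list \<Rightarrow> 'k::field) \<Rightarrow> 'a list \<Rightarrow> 'k" where
  "twist F = (\<lambda>xs. (-1) ^ length xs * F xs)"

definition smult :: "'k::field \<Rightarrow> ('a list \<Rightarrow> 'k) \<Rightarrow> 'a list \<Rightarrow> 'k" where
  "smult c F = (\<lambda>xs. c * F xs)"

definition wedge_unit :: "'a list \<Rightarrow> 'k::field" where
  "wedge_unit = (\<lambda>xs. if xs = [] then 1 else 0)"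

lemma smult_simps [simp]:
  "smult c F xs = c * F xs" "smult 1 F = F" "smult c (smult d F) = smult (c * d) F" "smult c 0 = 0"
  "smult 0 F = 0" "smult c (- F) = smult (- c) F"
  by (auto simp: smult_def)

lemma smult_add: "smult c (F + G) = smult c F + smult c G"
  by (auto simp: smult_def algebra_simps)

lemma smult_add_left: "smult (c + d) F = smult c F + smult d F"
  by (auto simp: smult_def algebra_simps)

lemma interiors_simps [simp]:
  "interiors [] F = F" "interiors (x # ys) F = interiors ys (interior x F)"
  "interiors ys F xs = F (ys @ xs)"
  by (auto simp: interiors_def interior_def)

lemma interior_simps [simp]:
  "interior x (F + G) = interior x F + interior x G"
  "interior x (- F) = - interior x F"
  "interior x (F - G) = interior x F - interior x G"
  "interior x (smult c F) = smult c (interior x F)"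
  "interior x 0 = 0"
  "interior x (twist F) = - twist (interior x F)"
  by (auto simp: interior_def smult_def twist_def fun_eq_iff)

lemma twist_simps [simp]:
  "twist (F + G) = twist F + twist G" "twist (- F) = - twist F" "twist 0 = 0"
  "twist (twist F) = F"
  by (auto simp: twist_def fun_eq_iff algebra_simps simp flip: power_add mult.assoc mult_2)

section \<open>Signs of shuffles and the Leibniz rule\<close>

abbreviation inversions :: "nat \<Rightarrow> nat set \<Rightarrow> nat" where
  "inversions n A \<equiv> card {(i, j). i \<in> A \<and> j \<in> {..<n} - A \<and> j < i}"

lemma finite_inversions:
  "A \<subseteq> {..<n::nat} \<Longrightarrow> finite {(i, j). i \<in> A \<and> j \<in> {..<n} - A \<and> j < i}"
  by (rule finite_subset[of _ "{..<n} \<times> {..<n}"]) auto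

text \<open>A new position 0 in the complement forms an inversion with every element of
  \<open>A\<close>; a new position 0 in \<open>A\<close> forms none.\<close>

lemma inversions_Suc:
  assumes "A \<subseteq> {..<n}"
  shows "inversions (Suc n) (Suc ` A) = inversions n A + card A"
    and "inversions (Suc n) (insert 0 (Suc ` A)) = inversions n A"
proof -
  let ?I = "{(i, j). i \<in> A \<and> j \<in> {..<n} - A \<and> j < i}"
  have fin: "finite ?I" "finite A"
    using finite_inversions[OF assms] finite_subset[OF assms] by simp_all
  have 1: "{(i, j). i \<in> Suc ` A \<and> j \<in> {..<Suc n} - Suc ` A \<and> j < i}
    = map_prod Suc Suc ` ?I \<union> (\<lambda>i. (Suc i, 0)) ` A" (is "?L = ?R")
  proof
    show "?L \<subseteq> ?R"
    proof
      fix z assume "z \<in> ?L"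
      then obtain a j where z: "z = (Suc a, j)" "a \<in> A" "j \<in> {..<Suc n} - Suc ` A" "j < Suc a"
        by auto
      then show "z \<in> ?R"
        by (cases j) (auto intro!: image_eqI[of _ _ "(a, j - 1)"])
    qed
    show "?R \<subseteq> ?L" by auto
  qed
  show "inversions (Suc n) (Suc ` A) = inversions n A + card A"
    unfolding 1 using fin
    by (subst card_Un_disjoint) (auto simp: card_image inj_on_def map_prod_def split: prod.splits)
  have 2: "{(i, j). i \<in> insert 0 (Suc ` A) \<and> j \<in> {..<Suc n} - insert 0 (Suc ` A) \<and> j < i}
    = map_prod Suc Suc ` ?I" (is "?L = ?R")
  proof
    show "?L \<subseteq> ?R"
    proof
      fix z assume "z \<in> ?L"
      then obtain i j where z: "z = (i, j)" "i \<in> insert 0 (Suc ` A)"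
        "j \<in> {..<Suc n} - insert 0 (Suc ` A)" "j < i"
        by auto
      then obtain i' j' where "i = Suc i'" "j = Suc j'" by (cases i; cases j) auto
      with z show "z \<in> ?R"
        by (auto intro!: image_eqI[of _ _ "(i', j')"])
    qed
    show "?R \<subseteq> ?L" by auto
  qed
  show "inversions (Suc n) (insert 0 (Suc ` A)) = inversions n A"
    unfolding 2 by (auto simp: card_image inj_on_def)
qed

lemma sum_Pow_Suc:
  fixes f :: "nat set \<Rightarrow> 'b::comm_monoid_add"
  shows "(\<Sum>A\<in>Pow {..<Suc n}. f A)
    = (\<Sum>A\<in>Pow {..<n}. f (insert 0 (Suc ` A))) + (\<Sum>A\<in>Pow {..<n}. f (Suc ` A))"
proof -
  have "Pow {..<Suc n} = Pow (Suc ` {..<n}) \<union> insert 0 ` Pow (Suc ` {..<n})"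
    by (simp only: lessThan_Suc_eq_insert_0 Pow_insert)
  also have "Pow (Suc ` {..<n}) = (`) Suc ` Pow {..<n}"
    by (rule image_Pow_surj[symmetric]) simp
  finally have P: "Pow {..<Suc n} = (\<lambda>A. insert 0 (Suc ` A)) ` Pow {..<n} \<union> (`) Suc ` Pow {..<n}"
    by (auto simp: image_image)
  have i1: "inj_on (\<lambda>A. insert 0 (Suc ` A)) (Pow {..<n})"
    by (rule inj_on_inverseI[where g = "\<lambda>A. {j. Suc j \<in> A}"]) auto
  have i2: "inj_on ((`) Suc) (Pow {..<n})"
    by (rule inj_onI) (simp add: inj_image_eq_iff)
  show ?thesis
    unfolding P by (subst sum.union_disjoint) (auto simp: sum.reindex[OF i1] sum.reindex[OF i2])
qed

lemma length_nths_subset: "A \<subseteq> {..<length xs} \<Longrightarrow> length (nths xs A) = card A"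
  by (auto simp: length_nths intro!: arg_cong[of _ _ card])

lemma nths_Cons_shift:
  "nths (x # xs) (insert 0 (Suc ` A)) = x # nths xs A"
  "nths (x # xs) (Suc ` A) = nths xs A"
  "nths (x # xs) ({..<Suc n} - insert 0 (Suc ` A)) = nths xs ({..<n} - A)"
  "nths (x # xs) ({..<Suc n} - Suc ` A) = x # nths xs ({..<n} - A)"
  by (auto simp: nths_Cons intro!: arg_cong[of _ _ "nths xs"])

lemma wedge_Nil [simp]: "(F \<and>\<^sub>e G) [] = F [] * G []"
  by (simp add: wedge_def)

text \<open>The shuffles are divided by the factor that receives the first argument. If it goes to
  \<open>G\<close>, all arguments of \<open>F\<close> are moved past it, whence
  \<open>twist F\<close>.\<close>

lemma wedge_Cons:
  "(F \<and>\<^sub>e G) (x # xs) = (interior x F \<and>\<^sub>e G) xs + (twist F \<and>\<^sub>e interior x G) xs"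
proof -
  have 1: "(-1) ^ inversions (Suc (length xs)) (insert 0 (Suc ` A))
        * F (nths (x # xs) (insert 0 (Suc ` A)))
        * G (nths (x # xs) ({..<Suc (length xs)} - insert 0 (Suc ` A)))
      = (-1) ^ inversions (length xs) A * interior x F (nths xs A) * G (nths xs ({..<length xs} - A))"
    if "A \<in> Pow {..<length xs}" for A
    using that by (simp only: inversions_Suc(2) nths_Cons_shift interior_def Pow_iff)
  have 2: "(-1) ^ inversions (Suc (length xs)) (Suc ` A)
        * F (nths (x # xs) (Suc ` A)) * G (nths (x # xs) ({..<Suc (length xs)} - Suc ` A))
      = (-1) ^ inversions (length xs) A * twist F (nths xs A) * interior x G (nths xs ({..<length xs} - A))"
    if "A \<in> Pow {..<length xs}" for A
    using that by (simp only: inversions_Suc(1) nths_Cons_shift interior_def twist_def Pow_iff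
        length_nths_subset power_add mult.assoc)
  show ?thesis
    unfolding wedge_def length_Cons sum_Pow_Suc
    by (intro arg_cong2[of _ _ _ _ "(+)"] sum.cong refl 1 2)
qed

lemma interior_wedge:
  "interior x (F \<and>\<^sub>e G) = interior x F \<and>\<^sub>e G + twist F \<and>\<^sub>e interior x G"
  by (simp add: interior_def wedge_Cons fun_eq_iff)

lemma wedge_bilinear [simp]:
  "(F + F') \<and>\<^sub>e G = F \<and>\<^sub>e G + F' \<and>\<^sub>e G"
  "F \<and>\<^sub>e (G + G') = F \<and>\<^sub>e G + F \<and>\<^sub>e G'"
  "(- F) \<and>\<^sub>e G = - (F \<and>\<^sub>e G)"
  "F \<and>\<^sub>e (- G) = - (F \<and>\<^sub>e G)"
  "(F - F') \<and>\<^sub>e G = F \<and>\<^sub>e G - F' \<and>\<^sub>e G"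
  "F \<and>\<^sub>e (G - G') = F \<and>\<^sub>e G - F \<and>\<^sub>e G'"
  "smult c F \<and>\<^sub>e G = smult c (F \<and>\<^sub>e G)"
  "F \<and>\<^sub>e smult c G = smult c (F \<and>\<^sub>e G)"
  "0 \<and>\<^sub>e G = 0" "F \<and>\<^sub>e 0 = 0"
  by (auto simp: wedge_def fun_eq_iff smult_def algebra_simps sum.distrib sum_distrib_left
      sum_subtractf simp flip: sum_negf)

lemma twist_wedge: "twist (F \<and>\<^sub>e G) = twist F \<and>\<^sub>e twist G"
proof
  fix xs show "twist (F \<and>\<^sub>e G) xs = (twist F \<and>\<^sub>e twist G) xs"
  proof (induction xs arbitrary: F G)
    case Nil then show ?case by (simp add: twist_def)
  next
    case (Cons x xs)
    have "twist (F \<and>\<^sub>e G) (x # xs) = - twist (interior x (F \<and>\<^sub>e G)) xs"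
      by (simp add: twist_def interior_def)
    then show ?case by (simp add: interior_wedge wedge_Cons Cons.IH)
  qed
qed

text \<open>Both sides have the same Leibniz expansion into three terms, so induction on the
  arguments replaces a comparison of iterated shuffles.\<close>

lemma wedge_assoc: "(F \<and>\<^sub>e G) \<and>\<^sub>e H = F \<and>\<^sub>e G \<and>\<^sub>e H"
proof
  fix xs show "((F \<and>\<^sub>e G) \<and>\<^sub>e H) xs = (F \<and>\<^sub>e G \<and>\<^sub>e H) xs"
  proof (induction xs arbitrary: F G H)
    case (Cons x xs)
    then show ?case by (simp add: wedge_Cons interior_wedge twist_wedge)
  qed simp
qed

lemma wedge_unit_simps [simp]:
  "interior x wedge_unit = 0" "twist wedge_unit = wedge_unit" "wedge_unit [] = 1"
  by (auto simp: interior_def wedge_unit_def twist_def)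

lemma wedge_unit_wedge [simp]: "wedge_unit \<and>\<^sub>e F = F" "F \<and>\<^sub>e wedge_unit = F"
proof -
  have "(wedge_unit \<and>\<^sub>e F) xs = F xs \<and> (F \<and>\<^sub>e wedge_unit) xs = F xs" for xs
    by (induction xs arbitrary: F) (simp_all add: wedge_Cons, simp add: interior_def)
  then show "wedge_unit \<and>\<^sub>e F = F" "F \<and>\<^sub>e wedge_unit = F" by auto
qed

lemma wedge_list_simps [simp]:
  "wedge_list [] = wedge_unit" "wedge_list (F # Fs) = F \<and>\<^sub>e wedge_list Fs"
  by (simp_all add: wedge_list_def wedge_unit_def)

lemma wedge_eq_0_if_mem:
  assumes "\<And>ys. x \<in> set ys \<Longrightarrow> F ys = 0" "\<And>ys. x \<in> set ys \<Longrightarrow> G ys = 0" "x \<in> set xs"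
  shows "(F \<and>\<^sub>e G) xs = 0"
  unfolding wedge_def
proof (rule sum.neutral, rule ballI)
  fix A assume "A \<in> Pow {..<length xs}"
  obtain i where i: "i < length xs" "xs ! i = x" using assms(3) by (auto simp: in_set_conv_nth)
  have "x \<in> set (nths xs A) \<or> x \<in> set (nths xs ({..<length xs} - A))"
    using i by (cases "i \<in> A") (auto simp: set_nths)
  then show "(-1) ^ inversions (length xs) A * F (nths xs A) * G (nths xs ({..<length xs} - A)) = 0"
    using assms(1,2) by auto
qed

subsection \<open>Alternating functions\<close>

text \<open>A carrier set rather than a type: covectors form a subset of a function type, vectors
  fill a whole type, and the two kinds of alternating functions share one theory.\<close>

locale lin_set =
  fixes sc :: "'k::field_char_0 \<Rightarrow> 'a::ab_group_add \<Rightarrow> 'a" and S :: "'a set"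
  assumes zero_mem: "0 \<in> S"
    and add_mem: "x \<in> S \<Longrightarrow> y \<in> S \<Longrightarrow> x + y \<in> S"
    and diff_mem: "x \<in> S \<Longrightarrow> y \<in> S \<Longrightarrow> x - y \<in> S"
    and scale_mem: "x \<in> S \<Longrightarrow> sc c x \<in> S"
begin

lemma sum_mem: "(\<And>i. i \<in> A \<Longrightarrow> f i \<in> S) \<Longrightarrow> sum f A \<in> S"
  by (induction A rule: infinite_finite_induct) (auto simp: zero_mem add_mem)

abbreviation alt :: "int \<Rightarrow> ('a list \<Rightarrow> 'k) set" where
  "alt d \<equiv> alternating sc S d"

lemma alt_off: "F \<in> alt d \<Longrightarrow> int (length xs) \<noteq> d \<or> \<not> set xs \<subseteq> S \<Longrightarrow> F xs = 0"
  by (auto simp: alternating_def)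

lemma alt_not_distinct: "F \<in> alt d \<Longrightarrow> \<not> distinct xs \<Longrightarrow> F xs = 0"
  by (auto simp: alternating_def)

lemma alt_update:
  assumes "F \<in> alt d" "int (length xs) = d" "set xs \<subseteq> S" "i < length xs" "x \<in> S"
  shows "y \<in> S \<Longrightarrow> F (xs[i := x + y]) = F (xs[i := x]) + F (xs[i := y])"
    and "F (xs[i := sc c x]) = c * F (xs[i := x])"
  using assms unfolding alternating_def by blast+

lemma alt_add_at:
  assumes "F \<in> alt d" "x \<in> S" "y \<in> S"
  shows "F (ps @ (x + y) # qs) = F (ps @ x # qs) + F (ps @ y # qs)"
proof (cases "int (length (ps @ x # qs)) = d \<and> set (ps @ x # qs) \<subseteq> S")
  case True
  then have "F ((ps @ x # qs)[length ps := x + y])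
      = F ((ps @ x # qs)[length ps := x]) + F ((ps @ x # qs)[length ps := y])"
    using assms by (intro alt_update(1)[OF assms(1)]) auto
  then show ?thesis by simp
next
  case False
  then show ?thesis using assms add_mem by (subst (1 2 3) alt_off[OF assms(1)]) auto
qed

lemma alt_scale_at:
  assumes "F \<in> alt d" "x \<in> S"
  shows "F (ps @ sc c x # qs) = c * F (ps @ x # qs)"
proof (cases "int (length (ps @ x # qs)) = d \<and> set (ps @ x # qs) \<subseteq> S")
  case True
  then have "F ((ps @ x # qs)[length ps := sc c x]) = c * F ((ps @ x # qs)[length ps := x])"
    using assms by (intro alt_update(2)[OF assms(1)]) auto
  then show ?thesis by simp
next
  case False
  then show ?thesis using assms scale_mem by (subst (1 2) alt_off[OF assms(1)]) auto
qed

lemma alt_zero_at: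
  assumes "F \<in> alt d"
  shows "F (ps @ 0 # qs) = 0"
  using alt_add_at[OF assms zero_mem zero_mem, of ps qs] by simp

lemma alt_sum_at:
  assumes "F \<in> alt d" "finite A" "\<And>i. i \<in> A \<Longrightarrow> f i \<in> S"
  shows "sum f A \<in> S \<and> F (ps @ sum f A # qs) = (\<Sum>i\<in>A. F (ps @ f i # qs))"
  using assms(2,3)
  by (induction A rule: finite_induct)
    (auto simp: zero_mem alt_zero_at[OF assms(1)] add_mem alt_add_at[OF assms(1)])

text \<open>Polarization: \<open>F\<close> vanishes with \<open>x + y\<close> in both slots. If an
  entry lies outside \<open>S\<close>, both sides are 0.\<close>

lemma alt_swap:
  assumes F: "F \<in> alt d"
  shows "F (ps @ x # qs @ y # rs) = - F (ps @ y # qs @ x # rs)"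
proof (cases "x \<in> S \<and> y \<in> S")
  case True
  let ?L = "\<lambda>a b. F (ps @ a # qs @ b # rs)"
  have 1: "?L (x + y) b = ?L x b + ?L y b" for b
    using alt_add_at[OF F, of x y ps "qs @ b # rs"] True by simp
  have 2: "?L a (x + y) = ?L a x + ?L a y" for a
    using alt_add_at[OF F, of x y "ps @ a # qs" rs] True by simp
  have 3: "?L a a = 0" for a by (rule alt_not_distinct[OF F]) simp
  have "?L x y + ?L y x = ?L (x + y) (x + y)"
    unfolding 1 2 using 3[of x] 3[of y] by simp
  then show ?thesis using 3[of "x + y"] by (simp only: eq_neg_iff_add_eq_0)
next
  case False
  then show ?thesis by (subst (1 2) alt_off[OF F]) auto
qed

lemma alt_swap2:
  assumes "F \<in> alt d"
  shows "F (x # y # xs) = - F (y # x # xs)"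
  using alt_swap[OF assms, of "[]" x "[]" y xs] by simp

lemma alt_0: "0 \<in> alt d" by (auto simp: alternating_def)

lemma alt_add: "F \<in> alt d \<Longrightarrow> G \<in> alt d \<Longrightarrow> F + G \<in> alt d"
  by (auto simp: alternating_def algebra_simps)

lemma alt_diff: "F \<in> alt d \<Longrightarrow> G \<in> alt d \<Longrightarrow> F - G \<in> alt d"
  by (auto simp: alternating_def algebra_simps)

lemma alt_smult: "F \<in> alt d \<Longrightarrow> smult c F \<in> alt d"
  by (auto simp: alternating_def algebra_simps smult_def)

lemma alt_interior: 
  assumes "F \<in> alt d"
  shows "interior x F \<in> alt (d - 1)"
proof (cases "x \<in> S")
  case True
  have "F (x # (xs[i := a + b])) = F (x # (xs[i := a])) + F (x # (xs[i := b]))"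
    and "F (x # (xs[i := sc c a])) = c * F (x # (xs[i := a]))"
    if "int (length xs) = d - 1" "set xs \<subseteq> S" "i < length xs" "a \<in> S" "b \<in> S" for xs i a b c
    using that True alt_update[OF assms, of "x # xs" "Suc i" a] by auto
  moreover have "F (x # xs) = 0" if "int (length xs) \<noteq> d - 1 \<or> \<not> set xs \<subseteq> S" for xs
    using that by (intro alt_off[OF assms]) auto
  moreover have "F (x # xs) = 0" if "\<not> distinct xs" for xs
    using that by (intro alt_not_distinct[OF assms]) auto
  ultimately show ?thesis
    unfolding interior_def alternating_def by blast
next
  case False
  then have "interior x F xs = 0" for xs
    unfolding interior_def by (intro alt_off[OF assms]) simp
  then have "interior x F = 0" by (simp add: fun_eq_iff)
  then show ?thesis by (simp add: alt_0)
qed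

lemma alt_interior_out: "F \<in> alt d \<Longrightarrow> x \<notin> S \<Longrightarrow> interior x F = 0"
  using alt_off[of F d "x # xs" for xs] by (simp add: interior_def fun_eq_iff)

lemma alt_interiors: "F \<in> alt d \<Longrightarrow> interiors ys F \<in> alt (d - int (length ys))"
proof (induction ys arbitrary: F d)
  case (Cons y ys)
  from Cons.IH[OF alt_interior[OF Cons.prems]] show ?case by (simp add: algebra_simps)
qed simp

lemma alt_interior_add:
  assumes "F \<in> alt d" "x \<in> S" "y \<in> S"
  shows "interior (x + y) F = interior x F + interior y F"
  using alt_add_at[OF assms, of "[]"] by (auto simp: interior_def)

lemma alt_interior_scale:
  assumes "F \<in> alt d" "x \<in> S"
  shows "interior (sc c x) F = smult c (interior x F)"
  using alt_scale_at[OF assms, of "[]"] by (auto simp: interior_def smult_def)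

lemma alt_interior_interior:
  assumes "F \<in> alt d"
  shows "interior x (interior x F) = 0" "interior x (interior y F) = - interior y (interior x F)"
proof -
  show "interior x (interior x F) = 0"
    using alt_not_distinct[OF assms] by (simp add: interior_def fun_eq_iff)
  show "interior x (interior y F) = - interior y (interior x F)"
    by (rule ext) (simp only: interior_def fun_Compl_def, rule alt_swap2[OF assms])
qed

lemma alt_twist: "F \<in> alt d \<Longrightarrow> twist F = smult ((-1) ^ nat d) F"
  unfolding twist_def smult_def fun_eq_iff
  by (metis alt_off mult_zero_right nat_int)

lemma alt_twist_mem: "F \<in> alt d \<Longrightarrow> twist F \<in> alt d"
  by (simp add: alt_twist alt_smult)

text \<open>A criterion suited to wedge products: their interior multiplications are known from the
  Leibniz rule, whereas their values are sums over shuffles.\<close>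

lemma alt_recI:
  assumes nil: "d \<noteq> 0 \<Longrightarrow> F [] = 0"
    and mem: "\<And>x. x \<in> S \<Longrightarrow> interior x F \<in> alt (d - 1)"
    and out: "\<And>x. x \<notin> S \<Longrightarrow> interior x F = 0"
    and add: "\<And>x y. x \<in> S \<Longrightarrow> y \<in> S \<Longrightarrow> interior (x + y) F = interior x F + interior y F"
    and scale: "\<And>c x. x \<in> S \<Longrightarrow> interior (sc c x) F = smult c (interior x F)"
    and sq: "\<And>x. x \<in> S \<Longrightarrow> interior x (interior x F) = 0"
  shows "F \<in> alt d"
proof -
  have I: "F (x # xs) = interior x F xs" for x xs by (simp add: interior_def)
  have off: "F xs = 0" if "int (length xs) \<noteq> d \<or> \<not> set xs \<subseteq> S" for xs
  proof (cases xs)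
    case (Cons x ys)
    show ?thesis
    proof (cases "x \<in> S")
      case True
      then show ?thesis using that Cons alt_off[OF mem[OF True], of ys] by (auto simp: I)
    qed (simp add: Cons I out)
  qed (use that nil in auto)
  have lin: "F (xs[i := x + y]) = F (xs[i := x]) + F (xs[i := y]) \<and>
      F (xs[i := sc c x]) = c * F (xs[i := x])"
    if H: "int (length xs) = d" "set xs \<subseteq> S" "i < length xs" "x \<in> S" "y \<in> S" for xs i x y c
  proof (cases i)
    case 0
    with H show ?thesis by (cases xs) (auto simp: I add scale smult_def)
  next
    case (Suc j)
    with H obtain z zs where xs: "xs = z # zs" by (cases xs) auto
    then have z: "interior z F \<in> alt (d - 1)" "int (length zs) = d - 1" "set zs \<subseteq> S" "j < length zs"
      using H Suc mem by auto
    show ?thesis using xs Suc alt_update[OF z H(4)] H(5) by (simp add: I)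
  qed
  have dist: "F xs = 0" if H: "\<not> distinct xs" for xs
  proof (cases xs)
    case (Cons x ys)
    show ?thesis
    proof (cases "x \<in> S")
      case True
      show ?thesis
      proof (cases "distinct ys")
        case False
        then show ?thesis using alt_not_distinct[OF mem[OF True]] Cons by (simp add: I)
      next
        case d: True
        with H Cons have "x \<in> set ys" by simp
        then obtain ps qs where ys: "ys = ps @ x # qs" by (meson split_list)
        show ?thesis
        proof (cases ps)
          case Nil
          then show ?thesis using sq[OF True] by (simp add: Cons ys I) (simp add: interior_def fun_eq_iff)
        next
          case (Cons p ps')
          \<comment> \<open>A swap inside \<open>interior x F\<close>, which is already alternating,
            brings the second \<open>x\<close> next to the first, where \<open>sq\<close>
            applies.\<close>
          have "F xs = - F (x # x # ps' @ p # qs)"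
            using alt_swap[OF mem[OF True], of "[]" p ps' x qs] \<open>xs = x # ys\<close> ys Cons by (simp add: I)
          also have "F (x # x # ps' @ p # qs) = 0"
            using sq[OF True] by (simp add: interior_def fun_eq_iff)
          finally show ?thesis by simp
        qed
      qed
    qed (simp add: Cons I out)
  qed (use H in simp)
  show ?thesis
    unfolding alternating_def using off lin dist by blast
qed

lemma alt_neg_degree: "d < 0 \<Longrightarrow> F \<in> alt d \<Longrightarrow> F = 0"
  using alt_off[of F d xs for xs] by (simp add: fun_eq_iff)

lemma alt_interior_deg0: "F \<in> alt 0 \<Longrightarrow> interior x F = 0"
  by (rule alt_neg_degree[OF _ alt_interior]) auto

text \<open>Induction on the total degree. In the square of an interior multiplication the two mixed
  terms cancel, because \<open>interior x\<close> anticommutes with \<open>twist\<close>.\<close>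

lemma alt_wedge:
  "F \<in> alt p \<Longrightarrow> G \<in> alt q \<Longrightarrow> F \<and>\<^sub>e G \<in> alt (p + q)"
proof (induction "nat p + nat q" arbitrary: p q F G rule: less_induct)
  case less
  note F = less.prems(1) and G = less.prems(2)
  show ?case
  proof (cases "p < 0 \<or> q < 0")
    case True
    then have "F = 0 \<or> G = 0" using alt_neg_degree F G by blast
    then show ?thesis by (auto simp: alt_0)
  next
    case False
    have twist_interior: "interior x F \<and>\<^sub>e G \<in> alt (p + q - 1)" "twist F \<and>\<^sub>e interior x G \<in> alt (p + q - 1)" for x
    proof -
      show "interior x F \<and>\<^sub>e G \<in> alt (p + q - 1)"
      \<comment> \<open>The measure uses \<open>nat\<close> and cannot drop below degree 0; there
        the interior multiplication itself is 0.\<close>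
      proof (cases "p = 0")
        case True
        then show ?thesis using F by (simp add: alt_interior_deg0 alt_0)
      next
        case p: False
        have "interior x F \<and>\<^sub>e G \<in> alt (p - 1 + q)"
          by (rule less.hyps[OF _ alt_interior[OF F] G]) (use False p in auto)
        then show ?thesis by (simp add: algebra_simps)
      qed
      show "twist F \<and>\<^sub>e interior x G \<in> alt (p + q - 1)"
      proof (cases "q = 0")
        case True
        then show ?thesis using G by (simp add: alt_interior_deg0 alt_0)
      next
        case q: False
        have "twist F \<and>\<^sub>e interior x G \<in> alt (p + (q - 1))"
          by (rule less.hyps[OF _ alt_twist_mem[OF F] alt_interior[OF G]]) (use False q in auto)
        then show ?thesis by (simp add: algebra_simps)
      qed
    qed
    show ?thesis
    proof (rule alt_recI)
      show "(F \<and>\<^sub>e G) [] = 0" if "p + q \<noteq> 0"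
        using that alt_off[OF F, of "[]"] alt_off[OF G, of "[]"] by (cases "p = 0") auto
    qed (use twist_interior in \<open>simp_all add: interior_wedge alt_add alt_interior_out[OF F]
        alt_interior_out[OF G] alt_interior_add[OF F] alt_interior_add[OF G]
        alt_interior_scale[OF F] alt_interior_scale[OF G] alt_interior_interior(1)[OF F]
        alt_interior_interior(1)[OF G] smult_add algebra_simps\<close>)
  qed
qed

text \<open>The Leibniz expansions have the same two terms in opposite order. Lowering one degree
  changes the exponent by the other degree, which is the sign supplied by
  \<open>twist\<close>.\<close>

lemma alt_wedge_commute:
  "F \<in> alt p \<Longrightarrow> G \<in> alt q \<Longrightarrow> F \<and>\<^sub>e G = smult ((-1) ^ (nat p * nat q)) (G \<and>\<^sub>e F)"
proof
  fix xs
  show "F \<in> alt p \<Longrightarrow> G \<in> alt q \<Longrightarrow>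
    (F \<and>\<^sub>e G) xs = smult ((-1) ^ (nat p * nat q)) (G \<and>\<^sub>e F) xs"
  proof (induction xs arbitrary: F G p q)
    case Nil
    then show ?case
      using alt_off[OF Nil(1), of "[]"] alt_off[OF Nil(2), of "[]"]
      by (cases "p = 0") (auto simp: smult_def)
  next
    case (Cons x xs)
    note F = Cons.prems(1) and G = Cons.prems(2)
    have 1: "(interior x F \<and>\<^sub>e G) xs
      = (-1) ^ (nat p * nat q) * (twist G \<and>\<^sub>e interior x F) xs"
    proof (cases "p \<le> 0")
      case True
      then have "interior x F = 0"
        using alt_neg_degree[OF _ alt_interior[OF F]] by simp
      then show ?thesis by simp
    next
      case False
      then obtain m where m: "nat p = Suc m" "nat (p - 1) = m" by (cases "nat p") auto
      show ?thesis
        using Cons.IH[OF alt_interior[OF F] G]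
        by (simp add: alt_twist[OF G] m power_add flip: power_mult_distrib)
    qed
    have 2: "(twist F \<and>\<^sub>e interior x G) xs
      = (-1) ^ (nat p * nat q) * (interior x G \<and>\<^sub>e F) xs"
    proof (cases "q \<le> 0")
      case True
      then have "interior x G = 0"
        using alt_neg_degree[OF _ alt_interior[OF G]] by simp
      then show ?thesis by simp
    next
      case False
      then obtain m where m: "nat q = Suc m" "nat (q - 1) = m" by (cases "nat q") auto
      show ?thesis
        using Cons.IH[OF F alt_interior[OF G]]
        by (simp add: alt_twist[OF F] m power_add flip: power_mult_distrib)
    qed
    show ?case
      by (simp add: wedge_Cons 1 2 algebra_simps)
  qed
qed

lemma alt_permute:
  assumes F: "F \<in> alt d" and "\<pi> permutes {..<n}"
  shows "length xs = n \<Longrightarrow> F (map (\<lambda>i. xs ! \<pi> i) [0..<n]) = of_int (sign \<pi>) * F xs"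
  using assms(2) finite_lessThan
proof (induction arbitrary: xs rule: permutes_induct)
  case id
  then show ?case using map_nth[of xs] by simp
next
  case (swap a b p)
  let ?t = "Transposition.transpose a b"
  let ?ys = "map (\<lambda>i. xs ! ?t i) [0..<n]"
  have p: "p i < n" if "i < n" for i
    using permutes_in_image[OF \<open>p permutes {..<n}\<close>] that by fastforce
  have "map (\<lambda>i. xs ! (?t \<circ> p) i) [0..<n] = map (\<lambda>i. ?ys ! p i) [0..<n]"
    using p by (auto simp del: map_eq_conv intro!: map_cong)
  then have 1: "F (map (\<lambda>i. xs ! (?t \<circ> p) i) [0..<n]) = of_int (sign p) * F ?ys"
    using swap.IH[of ?ys] by (simp only: length_map length_upt minus_nat.diff_0)
  have swp: "F (map (\<lambda>i. xs ! Transposition.transpose a b i) [0..<n]) = - F xs"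
    if "a < b" "b < n" for a b
  proof -
    let ?ps = "take a xs" and ?qs = "drop (Suc a) (take b xs)" and ?rs = "drop (Suc b) xs"
    have len: "length xs = n" by fact
    have "xs = take b xs @ xs ! b # ?rs" using that len by (simp add: id_take_nth_drop)
    also have "take b xs = take a (take b xs) @ take b xs ! a # drop (Suc a) (take b xs)"
      using that len by (intro id_take_nth_drop) simp
    finally have xs: "xs = ?ps @ xs ! a # ?qs @ xs ! b # ?rs" using that by simp
    have "map (\<lambda>i. xs ! Transposition.transpose a b i) [0..<n] = ?ps @ xs ! b # ?qs @ xs ! a # ?rs"
      (is "?l = ?r")
    proof (rule nth_equalityI)
      show "length ?l = length ?r" using that len by auto
      fix i assume "i < length ?l"
      then show "?l ! i = ?r ! i"
        using that len
        by (auto simp: nth_append nth_Cons' Transposition.transpose_def not_less min_def)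
    qed
    then show ?thesis using alt_swap[OF F, of ?ps "xs ! b" ?qs "xs ! a" ?rs] xs by simp
  qed
  have ab: "a < n" "b < n" "a \<noteq> b" using swap.hyps by auto
  then have "F ?ys = - F xs"
    using swp[of a b] swp[of b a] by (metis linorder_neqE_nat transpose_commute)
  then have "F ?ys = of_int (sign ?t) * F xs"
    using ab by (simp add: sign_swap_id)
  moreover have "sign (?t \<circ> p) = sign ?t * sign p"
    by (rule sign_compose) (use \<open>p permutes {..<n}\<close> in \<open>auto intro: permutation_swap_id permutation_permutes[THEN iffD2]\<close>)
  ultimately show ?case by (simp only: 1 of_int_mult ac_simps)
qed

end

subsection \<open>The three-term relations\<close>

text \<open>No carrier set appears: each product contains all of \<open>a\<close>, \<open>b\<close>,
  \<open>c\<close>, \<open>d\<close> and \<open>\<gamma>\<close>, so for alternating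
  \<open>P\<close> an entry outside the carrier makes every term 0.\<close>

definition three_term :: "nat \<Rightarrow> ('a list \<Rightarrow> 'k::field) \<Rightarrow> bool" where
  "three_term s P \<longleftrightarrow> (\<forall>\<gamma> a b c d. length \<gamma> + 2 = s \<longrightarrow>
     P (\<gamma> @ [a, b]) * P (\<gamma> @ [c, d]) - P (\<gamma> @ [a, c]) * P (\<gamma> @ [b, d])
       + P (\<gamma> @ [a, d]) * P (\<gamma> @ [b, c]) = 0)"

text \<open>Only the last two arguments vary. The \<open>s - 2\<close> fixed ones can be split into
  \<open>s - k\<close> inserted beforehand and \<open>k - 2\<close> that remain, so condition (3)
  has the same content for each \<open>k\<close>.\<close>

lemma three_term_interiors:
  "(\<forall>\<gamma>. length \<gamma> + k = s \<longrightarrow> three_term k (interiors \<gamma> P)) \<longleftrightarrow> three_term s P"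
  if "2 \<le> k" "k \<le> s"
proof
  assume *: "\<forall>\<gamma>. length \<gamma> + k = s \<longrightarrow> three_term k (interiors \<gamma> P)"
  show "three_term s P"
    unfolding three_term_def
  proof (intro allI impI)
    fix \<gamma> :: "'a list" and a b c d assume len: "length \<gamma> + 2 = s"
    have "three_term k (interiors (take (s - k) \<gamma>) P)"
      using * len that by auto
    moreover have "length (drop (s - k) \<gamma>) + 2 = k" using len that by auto
    ultimately show "P (\<gamma> @ [a, b]) * P (\<gamma> @ [c, d]) - P (\<gamma> @ [a, c]) * P (\<gamma> @ [b, d])
       + P (\<gamma> @ [a, d]) * P (\<gamma> @ [b, c]) = 0"
      unfolding three_term_def interiors_simps
      by (metis append_assoc append_take_drop_id)
  qed
next
  assume *: "three_term s P"
  have "three_term k (interiors \<gamma> P)" if "length \<gamma> + k = s" for \<gamma>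
    unfolding three_term_def
  proof (intro allI impI)
    fix \<delta> :: "'a list" and a b c d assume "length \<delta> + 2 = k"
    then have "length (\<gamma> @ \<delta>) + 2 = s" using that by simp
    from *[unfolded three_term_def, rule_format, OF this, of a b c d]
    show "interiors \<gamma> P (\<delta> @ [a, b]) * interiors \<gamma> P (\<delta> @ [c, d])
      - interiors \<gamma> P (\<delta> @ [a, c]) * interiors \<gamma> P (\<delta> @ [b, d])
       + interiors \<gamma> P (\<delta> @ [a, d]) * interiors \<gamma> P (\<delta> @ [b, c]) = 0"
      by simp
  qed
  then show "\<forall>\<gamma>. length \<gamma> + k = s \<longrightarrow> three_term k (interiors \<gamma> P)" by blast
qed

lemma sum_Pow_insert:
  assumes "finite N" "m \<notin> N"
  shows "sum f (Pow (insert m N)) = (\<Sum>K\<in>Pow N. f (insert m K)) + (\<Sum>K\<in>Pow N. f K)"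
proof -
  have "inj_on (insert m) (Pow N)"
    using assms(2) by (intro inj_onI) (metis Pow_iff insert_ident subsetD)
  moreover have "Pow N \<inter> insert m ` Pow N = {}" using assms(2) by auto
  ultimately show ?thesis
    using assms(1) by (simp add: Pow_insert sum.union_disjoint sum.reindex add.commute)
qed

lemma permutes_extend:
  assumes "finite A" "J \<subseteq> A" "inj_on \<sigma> J" "\<sigma> ` J \<subseteq> A"
  obtains \<pi> where "\<pi> permutes A" "\<And>j. j \<in> J \<Longrightarrow> \<pi> j = \<sigma> j"
proof -
  have fin: "finite J" using assms finite_subset by blast
  have "card (A - J) = card (A - \<sigma> ` J)"
    using assms fin by (simp add: card_Diff_subset card_image)
  then obtain g where g: "bij_betw g (A - J) (A - \<sigma> ` J)"
    using finite_same_card_bij[of "A - J" "A - \<sigma> ` J"] assms(1) by auto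
  define \<pi> where "\<pi> i = (if i \<in> J then \<sigma> i else if i \<in> A then g i else i)" for i
  have 1: "bij_betw \<pi> J (\<sigma> ` J)"
    using assms(3) by (simp add: \<pi>_def bij_betw_def inj_on_def)
  have 2: "bij_betw \<pi> (A - J) (A - \<sigma> ` J)"
    using g by (rule bij_betw_cong[THEN iffD1, rotated]) (simp add: \<pi>_def)
  have "bij_betw \<pi> (J \<union> (A - J)) (\<sigma> ` J \<union> (A - \<sigma> ` J))"
    by (rule bij_betw_combine[OF 1 2]) auto
  then have "bij_betw \<pi> A A" using assms(2,4) by (simp add: Un_absorb1)
  then have "\<pi> permutes A"
    by (rule bij_imp_permutes) (use assms(2) in \<open>auto simp: \<pi>_def\<close>)
  then show thesis by (rule that) (simp add: \<pi>_def)
qed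

context lin_set begin

text \<open>Entries that annihilate \<open>F\<close> can go only to \<open>G\<close>, and each of
  them passes the \<open>p\<close> arguments of \<open>F\<close>.\<close>

lemma wedge_append_absorb:
  assumes "F \<in> alt p" "\<And>g ys. g \<in> set gs \<Longrightarrow> F (g # ys) = 0"
  shows "(F \<and>\<^sub>e G) (gs @ xs) = (-1) ^ (nat p * length gs) * (F \<and>\<^sub>e interiors gs G) xs"
  using assms(2)
proof (induction gs arbitrary: G)
  case (Cons g gs)
  have "interior g F = 0" using Cons.prems by (simp add: interior_def fun_eq_iff)
  then show ?case
    using Cons.IH[of "interior g G"] Cons.prems
    by (simp add: wedge_Cons alt_twist[OF assms(1)] power_add)
qed simp

text \<open>Inserting an entry of \<open>\<gamma>\<close> into \<open>interiors \<gamma> P\<close>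
  repeats an argument, so \<open>\<gamma>\<close> is absorbed by the second factor. The six shuffles
  of the other four arguments give each product twice, and the 2 is cancelled.\<close>

lemma three_term_if_plucker2:
  assumes P: "P \<in> alt (int s)"
    and rel: "\<And>\<gamma>. length \<gamma> + 2 = s \<Longrightarrow> interiors \<gamma> P \<and>\<^sub>e P = 0"
  shows "three_term s P"
  unfolding three_term_def
proof (intro allI impI)
  fix \<gamma> :: "'a list" and a b c d assume len: "length \<gamma> + 2 = s"
  let ?Q = "interiors \<gamma> P"
  have Q: "?Q \<in> alt 2" using alt_interiors[OF P, of \<gamma>] len by auto
  have "(?Q \<and>\<^sub>e P) (\<gamma> @ [a, b, c, d]) = 0" using rel[OF len] by simp
  then have "(?Q \<and>\<^sub>e ?Q) [a, b, c, d] = 0"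
    by (subst (asm) wedge_append_absorb[OF Q]) (auto intro!: alt_not_distinct[OF P])
  moreover have "?Q xs = 0" if "length xs \<noteq> 2" for xs
    using that by (intro alt_off[OF Q]) auto
  ultimately have "2 * (?Q [a, b] * ?Q [c, d] - ?Q [a, c] * ?Q [b, d] + ?Q [a, d] * ?Q [b, c]) = 0"
    by (simp add: wedge_Cons interior_def twist_def algebra_simps del: interiors_simps(3))
  then show "P (\<gamma> @ [a, b]) * P (\<gamma> @ [c, d]) - P (\<gamma> @ [a, c]) * P (\<gamma> @ [b, d])
       + P (\<gamma> @ [a, d]) * P (\<gamma> @ [b, c]) = 0"
    by (simp only: mult_eq_0_iff) simp
qed

text \<open>With \<open>a\<close> also inserted into the first factor, that factor is a 1-vector,
  and its three shuffles with \<open>?Q\<close> on \<open>b\<close>, \<open>c\<close>,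
  \<open>d\<close> are the three terms, each occurring once.\<close>

lemma three_term_if_plucker1:
  assumes P: "P \<in> alt (int s)"
    and rel: "\<And>\<gamma>. length \<gamma> + 1 = s \<Longrightarrow> interiors \<gamma> P \<and>\<^sub>e P = 0"
  shows "three_term s P"
  unfolding three_term_def
proof (intro allI impI)
  fix \<gamma> :: "'a list" and a b c d assume len: "length \<gamma> + 2 = s"
  let ?Q = "interiors \<gamma> P" and ?v = "interiors (\<gamma> @ [a]) P"
  have Q: "?Q \<in> alt 2" using alt_interiors[OF P, of \<gamma>] len by auto
  have v: "?v \<in> alt 1" using alt_interiors[OF P, of "\<gamma> @ [a]"] len by auto
  have "(?v \<and>\<^sub>e P) (\<gamma> @ [b, c, d]) = 0" using rel[of "\<gamma> @ [a]"] len by simp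
  then have "(?v \<and>\<^sub>e ?Q) [b, c, d] = 0"
    by (subst (asm) wedge_append_absorb[OF v]) (auto intro!: alt_not_distinct[OF P])
  moreover have "?Q xs = 0" if "length xs \<noteq> 2" for xs
    using that by (intro alt_off[OF Q]) auto
  moreover have "?v xs = 0" if "length xs \<noteq> 1" for xs
    using that by (intro alt_off[OF v]) auto
  ultimately have "?v [b] * ?Q [c, d] - ?v [c] * ?Q [b, d] + ?v [d] * ?Q [b, c] = 0"
    by (simp add: wedge_Cons interior_def twist_def algebra_simps del: interiors_simps)
  then show "P (\<gamma> @ [a, b]) * P (\<gamma> @ [c, d]) - P (\<gamma> @ [a, c]) * P (\<gamma> @ [b, d])
       + P (\<gamma> @ [a, d]) * P (\<gamma> @ [b, c]) = 0"
    by simp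
qed

section \<open>Vanishing of an alternating function on entries from a subspace\<close>

lemma alt_map_update:
  assumes "F \<in> alt d" "i < n" "x \<in> S" "y \<in> S"
  shows "F (map (f(i := x + y)) [0..<n]) = F (map (f(i := x)) [0..<n]) + F (map (f(i := y)) [0..<n])"
proof -
  have "map (f(i := z)) [0..<n] = map f [0..<i] @ z # map f [Suc i..<n]" for z
  proof -
    have "[0..<n] = [0..<i] @ i # [Suc i..<n]"
      using assms(2) by (metis less_imp_le_nat upt_conv_Cons upt_add_eq_append le_add_diff_inverse le0)
    then show ?thesis by simp
  qed
  then show ?thesis using alt_add_at[OF assms(1,3,4)] by simp
qed

lemma alt_expand:
  assumes F: "F \<in> alt d" and "finite N" "N \<subseteq> {..<n}"
    and "\<And>i. i \<in> N \<Longrightarrow> x i \<in> S" "\<And>i. i \<in> N \<Longrightarrow> y i \<in> S"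
  shows "F (map (\<lambda>i. if i \<in> N then x i + y i else z i) [0..<n])
    = (\<Sum>K\<in>Pow N. F (map (\<lambda>i. if i \<in> K then x i else if i \<in> N then y i else z i) [0..<n]))"
  using assms(2-)
proof (induction N arbitrary: z rule: finite_induct)
  case (insert m N)
  let ?h = "\<lambda>z i. if i \<in> N then x i + y i else z i"
  have h: "(?h z)(m := c) = ?h (z(m := c))" for c
    using insert.hyps by auto
  have "F (map (\<lambda>i. if i \<in> insert m N then x i + y i else z i) [0..<n])
      = F (map ((?h z)(m := x m + y m)) [0..<n])"
    by (intro arg_cong[of _ _ F] map_cong) auto
  also have "\<dots> = F (map (?h (z(m := x m))) [0..<n]) + F (map (?h (z(m := y m))) [0..<n])"
    using alt_map_update[OF F, of m n "x m" "y m" "?h z"] insert.prems unfolding h by simp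
  also have "F (map (?h (z(m := x m))) [0..<n]) = (\<Sum>K\<in>Pow N. F (map (\<lambda>i. if i \<in> insert m K then x i
      else if i \<in> insert m N then y i else z i) [0..<n]))"
    using insert.hyps insert.prems
    by (subst insert.IH; (intro sum.cong refl arg_cong[of _ _ F] map_cong)?) auto
  also have "F (map (?h (z(m := y m))) [0..<n]) = (\<Sum>K\<in>Pow N. F (map (\<lambda>i. if i \<in> K then x i
      else if i \<in> insert m N then y i else z i) [0..<n]))"
    using insert.hyps insert.prems
    by (subst insert.IH; (intro sum.cong refl arg_cong[of _ _ F] map_cong)?) auto
  finally show ?case
    by (simp only: sum_Pow_insert[OF insert.hyps(1,2)])
qed simp

lemma three_term_at:
  fixes f :: "nat \<Rightarrow> 'a"
  assumes P: "P \<in> alt (int s)" "three_term s P" and ab: "a < s" "b < s" "a \<noteq> b"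
  defines "G \<equiv> \<lambda>x y. P (map (f(a := x, b := y)) [0..<s])"
  shows "G p q * G r t - G p r * G q t + G p t * G q r = 0"
proof -
  \<comment> \<open>The first transposition already moves \<open>b\<close> when
    \<open>b = s - 2\<close>. With \<open>b'\<close> the composite sends \<open>s - 2\<close> to
    \<open>a\<close> and \<open>s - 1\<close> to \<open>b\<close> in every case.\<close>
  define b' where "b' = Transposition.transpose a (s - 2) b"
  define \<pi> where "\<pi> = Transposition.transpose a (s - 2) \<circ> Transposition.transpose b' (s - 1)"
  have b': "b' < s" "b' \<noteq> s - 2" using ab by (auto simp: b'_def Transposition.transpose_def)
  have perm: "\<pi> permutes {..<s}"
    unfolding \<pi>_def using ab b' by (intro permutes_compose permutes_swap_id) auto
  have \<pi>: "\<pi> (s - 1) = b" "\<pi> (s - 2) = a"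
    using ab b' by (auto simp: \<pi>_def b'_def Transposition.transpose_def)
  have inj: "\<pi> i = \<pi> j \<longleftrightarrow> i = j" for i j
    using permutes_inj[OF perm] by (auto simp: inj_on_def)
  have [simp]: "\<pi> i \<noteq> a" "\<pi> i \<noteq> b" if "i < s - 2" for i
    using that inj[of i "s - 2"] inj[of i "s - 1"] ab \<pi> by auto
  have \<pi>_less: "\<pi> i < s" if "i < s" for i
    using permutes_in_image[OF perm] that by auto
  let ?\<gamma> = "map (f \<circ> \<pi>) [0..<s - 2]"
  have G: "P (?\<gamma> @ [x, y]) = of_int (sign \<pi>) * G x y" for x y
  proof -
    have "[0..<s] = [0..<s - 2] @ [s - 2, s - 1]"
      using ab by (cases s; cases "s - 1") auto
    then have "?\<gamma> @ [x, y] = map (\<lambda>i. (f(a := x, b := y)) (\<pi> i)) [0..<s]"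
      using ab \<pi> by auto
    also have "\<dots> = map (\<lambda>i. map (f(a := x, b := y)) [0..<s] ! \<pi> i) [0..<s]"
      using \<pi>_less by (intro map_cong) auto
    finally show ?thesis
      using alt_permute[OF P(1) perm] by (simp add: G_def)
  qed
  have "length ?\<gamma> + 2 = s" using ab by auto
  from P(2)[unfolded three_term_def, rule_format, OF this, of p q r t]
  \<comment> \<open>Every term is a product of two values of \<open>P\<close>, so the sign of the
    rearrangement enters squared.\<close>
  have "(of_int (sign \<pi>) * of_int (sign \<pi>)) * (G p q * G r t - G p r * G q t + G p t * G q r) = 0"
    unfolding G by (simp add: algebra_simps)
  then show ?thesis by (simp add: sign_def split: if_splits)
qed

text \<open>
  Replacing the entries \<open>\<alpha> i\<close>, \<open>i \<in> M - {a, b}\<close>, by \<open>w i + \<alpha> i\<close> in the three-term relation keeps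
  the coefficient \<open>P(\<dots>, \<alpha> a, \<alpha> b)\<close> equal to \<open>1\<close>.
\<close>

lemma three_term_vanish:
  fixes \<alpha> :: "nat \<Rightarrow> 'a"
  assumes P: "P \<in> alt (int s)" "three_term s P"
    and one: "P (map \<alpha> [0..<s]) = 1" and \<alpha>: "\<And>i. i < s \<Longrightarrow> \<alpha> i \<in> S"
  defines "W \<equiv> {w \<in> S. \<forall>i<s. P (map (\<alpha>(i := w)) [0..<s]) = 0}"
  assumes "M \<subseteq> {..<s}" "M \<noteq> {}" "\<And>i. i \<in> M \<Longrightarrow> w i \<in> W"
  shows "P (map (\<lambda>i. if i \<in> M then w i else \<alpha> i) [0..<s]) = 0"
  using assms(6-)
proof (induction "card M" arbitrary: M w rule: less_induct)
  case less
  define H where "H M w = P (map (\<lambda>i. if i \<in> M then w i else \<alpha> i) [0..<s])" for M w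
  have IH: "H K v = 0" if "card K < card M" "K \<subseteq> {..<s}" "K \<noteq> {}" "\<And>i. i \<in> K \<Longrightarrow> v i \<in> W" for K v
    unfolding H_def using less.hyps that by blast
  have finM: "finite M" using less.prems finite_subset by blast
  obtain a where a: "a \<in> M" using less.prems by blast
  show ?case
  proof (cases "M = {a}")
    case True
    have eq: "map (\<lambda>i. if i \<in> M then w i else \<alpha> i) [0..<s] = map (\<alpha>(a := w a)) [0..<s]"
      using True by auto
    have "w a \<in> W" "a < s" using less.prems a by auto
    then show ?thesis unfolding eq by (simp add: W_def)
  next
    case False
    then obtain b where b: "b \<in> M" "a \<noteq> b" using a by blast
    define N where "N = M - {a, b}"
    have N: "finite N" "N \<subseteq> {..<s}" "card M = card N + 2" "a \<notin> N" "b \<notin> N" "M = insert a (insert b N)"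
      using a b finM less.prems card_Diff_subset[of "{a, b}" M] card_mono[of M "{a, b}"]
      by (auto simp: N_def)
    have W: "w i \<in> S \<and> w i \<in> W" if "i \<in> M" for i using less.prems that by (auto simp: W_def)
    define f where "f i = (if i \<in> N then w i + \<alpha> i else \<alpha> i)" for i
    define E where "E x y = P (map (f(a := x, b := y)) [0..<s])" for x y
    have E: "E x y = (\<Sum>K\<in>Pow N. P (map (\<lambda>i. if i \<in> K then w i else (\<alpha>(a := x, b := y)) i) [0..<s]))" for x y
    proof -
      have "E x y = P (map (\<lambda>i. if i \<in> N then w i + \<alpha> i else (\<alpha>(a := x, b := y)) i) [0..<s])"
        unfolding E_def using N by (intro arg_cong[of _ _ P] map_cong) (auto simp: f_def)
      also have "\<dots> = (\<Sum>K\<in>Pow N. P (map (\<lambda>i. if i \<in> K then w i else if i \<in> N then \<alpha> i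
          else (\<alpha>(a := x, b := y)) i) [0..<s]))"
        using N W \<alpha> by (intro alt_expand[OF P(1)]) auto
      also have "\<dots> = (\<Sum>K\<in>Pow N. P (map (\<lambda>i. if i \<in> K then w i else (\<alpha>(a := x, b := y)) i) [0..<s]))"
        using N by (intro sum.cong refl arg_cong[of _ _ P] map_cong) auto
      finally show ?thesis .
    qed
    have card_le: "card K \<le> card N" "finite K" if "K \<in> Pow N" for K
      using that N(1) by (auto intro: card_mono finite_subset)
    have "E (\<alpha> a) (\<alpha> b) = (\<Sum>K\<in>Pow N. H K w)"
      unfolding E H_def by (intro sum.cong refl arg_cong[of _ _ P] map_cong) auto
    \<comment> \<open>A nonempty \<open>K\<close> puts elements of \<open>W\<close> into fewer than
      \<open>card M\<close> slots, so its term vanishes by induction; the empty set gives the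
      normalization.\<close>
    also have "\<dots> = (\<Sum>K\<in>{{}}. H K w)"
    proof (rule sum.mono_neutral_right)
      show "\<forall>K\<in>Pow N - {{}}. H K w = 0"
      proof
        fix K assume K: "K \<in> Pow N - {{}}"
        then have "card K < card M" using card_le(1)[of K] N(3) by simp
        then show "H K w = 0" using K N W by (intro IH) auto
      qed
    qed (use N in auto)
    also have "\<dots> = 1" using one by (simp add: H_def)
    finally have E1: "E (\<alpha> a) (\<alpha> b) = 1" .
    have E2: "E (\<alpha> a) r = 0" if r: "r \<in> W" for r
    proof -
      \<comment> \<open>Slot \<open>b\<close> holds an element of \<open>W\<close> and slot
        \<open>a\<close> does not, so all terms, including that of the empty \<open>K\<close>, fall
        under the induction. It is applied to \<open>w\<close> altered at \<open>b\<close>, hence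
        \<open>w\<close> is kept arbitrary.\<close>
      have "E (\<alpha> a) r = (\<Sum>K\<in>Pow N. H (insert b K) (w(b := r)))"
        unfolding E H_def using N by (intro sum.cong refl arg_cong[of _ _ P] map_cong) auto
      also have "\<dots> = 0"
      proof (rule sum.neutral, rule ballI)
        fix K assume K: "K \<in> Pow N"
        then have "card (insert b K) < card M" using card_le[OF K] N by (auto simp: card_insert_if)
        then show "H (insert b K) (w(b := r)) = 0"
          using K N W r b less.prems by (intro IH) auto
      qed
      finally show ?thesis .
    qed
    have "E (w a) (w b) = (\<Sum>K\<in>Pow N. H (insert a (insert b K)) w)"
      unfolding E H_def using N by (intro sum.cong refl arg_cong[of _ _ P] map_cong) auto
    also have "\<dots> = (\<Sum>K\<in>{N}. H (insert a (insert b K)) w)"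
    proof (rule sum.mono_neutral_right)
      show "\<forall>K\<in>Pow N - {N}. H (insert a (insert b K)) w = 0"
      proof
        fix K assume K: "K \<in> Pow N - {N}"
        then have "card K < card N" using N(1) by (auto intro: psubset_card_mono)
        then have "card (insert a (insert b K)) < card M"
          using K N card_le[of K] b by (auto simp: card_insert_if)
        then show "H (insert a (insert b K)) w = 0"
          using K N W a b less.prems by (intro IH) auto
      qed
    qed (use N in auto)
    also have "\<dots> = H M w" using N by simp
    finally have E3: "E (w a) (w b) = H M w" .
    \<comment> \<open>The last two products each contain a factor \<open>E (\<alpha> a) r\<close>
      with \<open>r\<close> in \<open>W\<close>, which is 0, so the first product vanishes.\<close>
    have "E (\<alpha> a) (\<alpha> b) * E (w a) (w b) - E (\<alpha> a) (w a) * E (\<alpha> b) (w b)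
        + E (\<alpha> a) (w b) * E (\<alpha> b) (w a) = 0"
      unfolding E_def by (rule three_term_at[OF P]) (use a b less.prems in auto)
    then have "H M w = 0" using E1 E2 E3 W a b by simp
    then show ?thesis by (simp add: H_def)
  qed
qed

text \<open>By linearity it suffices to test lists drawn from the \<open>\<alpha> i\<close> and
  \<open>W\<close>. Repeated arguments give 0; otherwise a permutation moves each occurring
  \<open>\<alpha> i\<close> into slot \<open>i\<close>, the other slots hold elements of
  \<open>W\<close>, and \<open>van\<close> applies.\<close>

lemma alt_eq_0_if_spanning:
  fixes \<alpha> :: "nat \<Rightarrow> 'a"
  assumes H: "H \<in> alt (int s)" and \<alpha>: "\<And>i. i < s \<Longrightarrow> \<alpha> i \<in> S"
    and W: "W \<subseteq> S"
    and span: "\<And>x. x \<in> S \<Longrightarrow> \<exists>c. \<exists>w\<in>W. x = (\<Sum>i<s. sc (c i) (\<alpha> i)) + w"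
    and van: "\<And>f. (\<And>i. i < s \<Longrightarrow> f i = \<alpha> i \<or> f i \<in> W) \<Longrightarrow> H (map f [0..<s]) = 0"
  shows "H = 0"
proof -
  let ?X = "\<alpha> ` {..<s} \<union> W"
  have X: "H xs = 0" if xs: "set xs \<subseteq> ?X" for xs
  proof (cases "length xs = s \<and> distinct xs")
    case True
    define J where "J = {j. j < s \<and> xs ! j \<in> \<alpha> ` {..<s}}"
    have "\<forall>j\<in>J. \<exists>i<s. xs ! j = \<alpha> i" by (auto simp: J_def)
    then obtain \<sigma> where \<sigma>: "\<And>j. j \<in> J \<Longrightarrow> \<sigma> j < s \<and> xs ! j = \<alpha> (\<sigma> j)" by metis
    have "inj_on \<sigma> J"
    proof (rule inj_onI)
      fix i j assume ij: "i \<in> J" "j \<in> J" "\<sigma> i = \<sigma> j"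
      then have "xs ! i = xs ! j" using \<sigma> by metis
      then show "i = j" using ij True by (simp add: J_def nth_eq_iff_index_eq)
    qed
    then obtain \<pi> where \<pi>: "\<pi> permutes {..<s}" "\<And>j. j \<in> J \<Longrightarrow> \<pi> j = \<sigma> j"
    proof (rule permutes_extend[OF finite_lessThan, rotated])
      show "J \<subseteq> {..<s}" by (auto simp: J_def)
      show "\<sigma> ` J \<subseteq> {..<s}" using \<sigma> by blast
    qed blast
    have "H (map (\<lambda>i. xs ! inv \<pi> i) [0..<s]) = 0"
    proof (rule van)
      fix i assume i: "i < s"
      let ?j = "inv \<pi> i"
      have j: "?j < s" "\<pi> ?j = i"
        using permutes_in_image[OF permutes_inv[OF \<pi>(1)], of i] i permutes_inverses[OF \<pi>(1)] by auto
      show "xs ! ?j = \<alpha> i \<or> xs ! ?j \<in> W"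
      proof (cases "?j \<in> J")
        case True
        then show ?thesis using \<sigma>[OF True] \<pi>(2)[OF True] j by simp
      next
        case False
        then have "xs ! ?j \<notin> \<alpha> ` {..<s}" using j by (simp add: J_def)
        then show ?thesis using xs j True nth_mem[of ?j xs] by blast
      qed
    qed
    then show ?thesis
      using alt_permute[OF H permutes_inv[OF \<pi>(1)], of xs] True by (simp add: sign_def split: if_splits)
  next
    case False
    then show ?thesis using alt_off[OF H, of xs] alt_not_distinct[OF H, of xs] by auto
  qed
  \<comment> \<open>Extension by linearity from the spanning set, one leading argument at a
    time.\<close>
  have int: "interior x F = 0" if F: "F \<in> alt d" "\<And>y. y \<in> ?X \<Longrightarrow> interior y F = 0" "x \<in> S" for F d x
  proof
    fix xs
    obtain c w where x: "w \<in> W" "x = (\<Sum>i<s. sc (c i) (\<alpha> i)) + w" using span[OF F(3)] by blast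
    have Y: "F (y # xs) = 0" if "y \<in> ?X" for y
      using F(2)[OF that] by (simp add: interior_def fun_eq_iff)
    let ?v = "\<Sum>i<s. sc (c i) (\<alpha> i)"
    have v: "?v \<in> S" "F (?v # xs) = (\<Sum>i<s. F (sc (c i) (\<alpha> i) # xs))"
      using alt_sum_at[OF F(1), of "{..<s}" "\<lambda>i. sc (c i) (\<alpha> i)" "[]" xs] \<alpha> scale_mem by auto
    have "F (sc (c i) (\<alpha> i) # xs) = 0" if "i < s" for i
      using alt_scale_at[OF F(1) \<alpha>[OF that], of "[]" "c i" xs] Y[of "\<alpha> i"] that by simp
    then have "F (?v # xs) = 0" unfolding v(2) by (intro sum.neutral) blast
    moreover have "F (w # xs) = 0" using Y x(1) by blast
    moreover have "F (x # xs) = F (?v # xs) + F (w # xs)"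
      using alt_add_at[OF F(1) v(1), of w "[]" xs] W x(1) unfolding x(2) append_Nil by blast
    ultimately show "interior x F xs = 0 xs" by (simp only: interior_def zero_fun_def add_0)
  qed
  have "F = 0" if "F \<in> alt (int n)" "\<And>xs. set xs \<subseteq> ?X \<Longrightarrow> F xs = 0" for F n
    using that
  proof (induction n arbitrary: F)
    case 0
    have "F xs = 0" for xs
      using 0(2)[of "[]"] alt_off[OF 0(1), of xs] by (cases xs) auto
    then show ?case by (simp add: fun_eq_iff)
  next
    case (Suc n)
    have "interior y F = 0" if "y \<in> ?X" for y
      using Suc.IH[of "interior y F"] alt_interior[OF Suc.prems(1), of y] that Suc.prems(2)
      by (auto simp: interior_def)
    then have 1: "interior x F = 0" for x
      using int[OF Suc.prems(1)] alt_interior_out[OF Suc.prems(1)] by blast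
    have "F xs = 0" for xs
      using Suc.prems(2)[of "[]"] 1 by (cases xs) (auto simp: interior_def fun_eq_iff)
    then show ?case by (simp add: fun_eq_iff)
  qed
  then show ?thesis using H X by blast
qed

end

subsection \<open>Decomposability\<close>

lemma interiors_linear [simp]:
  "interiors ys (F + G) = interiors ys F + interiors ys G"
  "interiors ys (F - G) = interiors ys F - interiors ys G"
  "interiors ys (- F) = - interiors ys F"
  "interiors ys (smult c F) = smult c (interiors ys F)"
  "interiors ys 0 = 0"
  by (auto simp: interiors_def)

text \<open>\<open>S\<close> supplies the arguments of multivectors and \<open>S'\<close> those of
  forms; \<open>expand\<close> and \<open>expand'\<close> express finite dimension through dual
  bases. The assumptions are symmetric in the two sides, so \<open>flip\<close> turns each result on
  multivectors into one on forms.\<close>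

locale dual_pair =
  X: lin_set sc S + Y: lin_set sc' S'
  for sc :: "'k::field_char_0 \<Rightarrow> 'a::ab_group_add \<Rightarrow> 'a" and S
    and sc' :: "'k \<Rightarrow> 'b::ab_group_add \<Rightarrow> 'b" and S' +
  fixes bil :: "'a \<Rightarrow> 'b \<Rightarrow> 'k" and B :: "'i set" and e :: "'i \<Rightarrow> 'a" and e' :: "'i \<Rightarrow> 'b"
  assumes finB: "finite B"
    and e_mem: "i \<in> B \<Longrightarrow> e i \<in> S" and e'_mem: "i \<in> B \<Longrightarrow> e' i \<in> S'"
    and bil_add_left: "x \<in> S \<Longrightarrow> y \<in> S \<Longrightarrow> v \<in> S' \<Longrightarrow> bil (x + y) v = bil x v + bil y v"
    and bil_add_right: "x \<in> S \<Longrightarrow> v \<in> S' \<Longrightarrow> w \<in> S' \<Longrightarrow> bil x (v + w) = bil x v + bil x w"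
    and bil_scale_left: "x \<in> S \<Longrightarrow> v \<in> S' \<Longrightarrow> bil (sc c x) v = c * bil x v"
    and bil_scale_right: "x \<in> S \<Longrightarrow> v \<in> S' \<Longrightarrow> bil x (sc' c v) = c * bil x v"
    and expand: "x \<in> S \<Longrightarrow> x = (\<Sum>i\<in>B. sc (bil x (e' i)) (e i))"
    and expand': "v \<in> S' \<Longrightarrow> v = (\<Sum>i\<in>B. sc' (bil (e i) v) (e' i))"
begin

lemma flip: "dual_pair sc' S' sc S (\<lambda>v x. bil x v) B e' e"
  by unfold_locales
    (rule finB e_mem e'_mem bil_add_left bil_add_right bil_scale_left bil_scale_right
      expand expand'; assumption)+

lemma bil_sum_left:
  assumes "finite A" "v \<in> S'" "\<And>i. i \<in> A \<Longrightarrow> f i \<in> S"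
  shows "sum f A \<in> S \<and> bil (sum f A) v = (\<Sum>i\<in>A. bil (f i) v)"
  using assms(1,3)
proof (induction A rule: finite_induct)
  case empty
  have "bil 0 v = 0" using bil_add_left[OF X.zero_mem X.zero_mem assms(2)] by simp
  then show ?case by (simp add: X.zero_mem)
qed (auto simp: X.add_mem bil_add_left assms(2))

lemma bil_sum_right:
  assumes "finite A" "x \<in> S" "\<And>i. i \<in> A \<Longrightarrow> f i \<in> S'"
  shows "sum f A \<in> S' \<and> bil x (sum f A) = (\<Sum>i\<in>A. bil x (f i))"
  using dual_pair.bil_sum_left[OF flip assms] .

definition vec :: "'b \<Rightarrow> 'a list \<Rightarrow> 'k" where
  "vec v = (\<lambda>xs. case xs of [x] \<Rightarrow> if x \<in> S then bil x v else 0 | _ \<Rightarrow> 0)"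

lemma vec_simps [simp]: "vec v [] = 0" "vec v [x] = (if x \<in> S then bil x v else 0)"
  "twist (vec v) = - vec v"
  "interior x (vec v) = smult (if x \<in> S then bil x v else 0) wedge_unit"
  by (auto simp: vec_def twist_def interior_def wedge_unit_def fun_eq_iff split: list.splits)

lemma wedge_unit_alt: "wedge_unit \<in> X.alt 0"
  by (rule X.alt_recI) (simp_all add: X.alt_0)

lemma vec_alt: "v \<in> S' \<Longrightarrow> vec v \<in> X.alt 1"
  by (rule X.alt_recI)
    (simp_all add: X.alt_smult wedge_unit_alt X.add_mem X.scale_mem bil_add_left bil_scale_left
      smult_add_left)

lemma wedge_list_vec_alt:
  "set vs \<subseteq> S' \<Longrightarrow> wedge_list (map vec vs) \<in> X.alt (int (length vs))"
proof (induction vs)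
  case (Cons v vs)
  then have "vec v \<and>\<^sub>e wedge_list (map vec vs) \<in> X.alt (1 + int (length vs))"
    by (intro X.alt_wedge vec_alt) auto
  then show ?case by simp
qed (simp add: wedge_unit_alt)

text \<open>The Leibniz expansions of the two sides agree; \<open>twist\<close> provides the sign
  for all degrees of \<open>F\<close> at once.\<close>

lemma vec_wedge_commute: "vec v \<and>\<^sub>e F = twist F \<and>\<^sub>e vec v"
proof
  fix xs show "(vec v \<and>\<^sub>e F) xs = (twist F \<and>\<^sub>e vec v) xs"
    by (induction xs arbitrary: F) (auto simp: wedge_Cons)
qed

lemma vec_wedge_self: "vec v \<and>\<^sub>e vec v = 0"
proof
  fix xs
  have "vec v \<and>\<^sub>e vec v = - (vec v \<and>\<^sub>e vec v)"
    using vec_wedge_commute[of v "vec v"] by (simp only: vec_simps wedge_bilinear)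
  from fun_cong[OF this, of xs] have "2 * (vec v \<and>\<^sub>e vec v) xs = 0"
    unfolding mult_2 by (simp only: fun_Compl_def eq_neg_iff_add_eq_0)
  then show "(vec v \<and>\<^sub>e vec v) xs = 0 xs" by simp
qed

lemma vec_wedge_list: "v \<in> set vs \<Longrightarrow> vec v \<and>\<^sub>e wedge_list (map vec vs) = 0"
proof (induction vs)
  case (Cons u vs)
  let ?R = "wedge_list (map vec vs)"
  have "vec v \<and>\<^sub>e vec u \<and>\<^sub>e ?R = - (vec u \<and>\<^sub>e vec v \<and>\<^sub>e ?R)"
    using vec_wedge_commute[of v "vec u"] by (simp flip: wedge_assoc)
  moreover have "vec u \<and>\<^sub>e vec u \<and>\<^sub>e ?R = 0"
    by (simp add: vec_wedge_self flip: wedge_assoc)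
  moreover have "vec v \<and>\<^sub>e ?R = 0" if "v \<noteq> u"
    by (rule Cons.IH) (use Cons.prems that in simp)
  ultimately show ?case
    unfolding list.map wedge_list_simps by (metis wedge_bilinear(10) neg_equal_0_iff_equal)
qed simp

text \<open>Fewer than \<open>Suc n\<close> insertions are distributed over \<open>vec u\<close> and
  \<open>F\<close>. If one of them consumes \<open>u\<close>, fewer than \<open>n\<close> fall on
  \<open>F\<close> and the hypothesis applies; otherwise \<open>u\<close> survives as a factor and
  annihilates \<open>G\<close>.\<close>

lemma interiors_vec_wedge:
  assumes "vec u \<and>\<^sub>e G = 0"
  shows "(\<And>\<gamma>. length \<gamma> < n \<Longrightarrow> interiors \<gamma> F \<and>\<^sub>e G = 0) \<Longrightarrow> length \<gamma> < Suc n \<Longrightarrow>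
    interiors \<gamma> (vec u \<and>\<^sub>e F) \<and>\<^sub>e G = 0"
proof (induction \<gamma> arbitrary: F n)
  case Nil
  have "(vec u \<and>\<^sub>e F) \<and>\<^sub>e G = twist F \<and>\<^sub>e vec u \<and>\<^sub>e G"
    by (simp add: vec_wedge_commute[of u F] wedge_assoc)
  then show ?case using assms by simp
next
  case (Cons g \<gamma>)
  then obtain m where n: "n = Suc m" by (cases n) auto
  have 1: "interiors \<gamma> F \<and>\<^sub>e G = 0" using Cons.prems(2) by (intro Cons.prems(1)) simp
  have 2: "interiors \<gamma> (vec u \<and>\<^sub>e interior g F) \<and>\<^sub>e G = 0"
  proof (rule Cons.IH)
    fix \<delta> :: "'a list" assume "length \<delta> < m"
    then show "interiors \<delta> (interior g F) \<and>\<^sub>e G = 0"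
      using Cons.prems(1)[of "g # \<delta>"] n by (simp only: interiors_simps(2) length_Cons Suc_less_eq)
  qed (use Cons.prems n in simp)
  show ?case
    by (simp only: interiors_simps(2) interior_wedge vec_simps wedge_bilinear wedge_unit_wedge
        interiors_linear 1 2 smult_simps(4) minus_zero add_0)
qed

lemma interiors_wedge_list:
  "(\<And>u. u \<in> set us \<Longrightarrow> vec u \<and>\<^sub>e G = 0) \<Longrightarrow> length \<gamma> < length us \<Longrightarrow>
    interiors \<gamma> (wedge_list (map vec us)) \<and>\<^sub>e G = 0"
proof (induction us arbitrary: \<gamma>)
  case (Cons u us)
  show ?case
    unfolding list.map wedge_list_simps
  proof (rule interiors_vec_wedge)
    show "length \<gamma> < Suc (length us)" using Cons.prems(2) by simp
    show "vec u \<and>\<^sub>e G = 0" by (rule Cons.prems(1)) simp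
  qed (rule Cons.IH[OF Cons.prems(1)], simp_all)
qed simp

lemma wedge_list_kill:
  "x \<in> set xs \<Longrightarrow> (\<And>u. u \<in> set us \<Longrightarrow> bil x u = 0) \<Longrightarrow> wedge_list (map vec us) xs = 0"
proof (induction us arbitrary: xs)
  case Nil
  then show ?case by (auto simp: wedge_unit_def)
next
  case (Cons u us)
  show ?case
    unfolding list.map wedge_list_simps
  proof (rule wedge_eq_0_if_mem[OF _ _ Cons.prems(1)])
    fix ys assume "x \<in> set ys"
    then show "vec u ys = 0" using Cons.prems(2)[of u] by (auto simp: vec_def split: list.splits)
    show "wedge_list (map vec us) ys = 0"
      by (rule Cons.IH[OF \<open>x \<in> set ys\<close> Cons.prems(2)]) simp
  qed
qed

text \<open>The determinant of the identity matrix: the first argument annihilates all factors but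
  the first, so a single term of the Leibniz expansion remains.\<close>

lemma wedge_list_dual:
  "length xs = length us \<Longrightarrow> set xs \<subseteq> S \<Longrightarrow>
    (\<And>i j. i < length us \<Longrightarrow> j < length us \<Longrightarrow> bil (xs ! i) (us ! j) = (if i = j then 1 else 0)) \<Longrightarrow>
    wedge_list (map vec us) xs = 1"
proof (induction us arbitrary: xs)
  case (Cons u us)
  then obtain x ys where xs: "xs = x # ys" by (cases xs) auto
  have "bil x v = 0" if "v \<in> set us" for v
    using that Cons.prems(3)[of 0 "Suc j" for j] xs by (auto simp: in_set_conv_nth)
  then have "wedge_list (map vec us) (x # zs) = 0" for zs
    by (intro wedge_list_kill[of x]) auto
  then have 1: "interior x (wedge_list (map vec us)) = 0" by (simp add: interior_def fun_eq_iff)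
  have "wedge_list (map vec us) ys = 1"
    using Cons.prems(1,2) Cons.prems(3)[of "Suc i" "Suc j" for i j] xs by (intro Cons.IH) auto
  moreover have "bil x u = 1" using Cons.prems(3)[of 0 0] xs by simp
  ultimately show ?case using Cons.prems(2) xs by (simp add: wedge_Cons 1)
qed simp

definition decomp :: "nat \<Rightarrow> ('a list \<Rightarrow> 'k) \<Rightarrow> bool" where
  "decomp s P \<longleftrightarrow> (\<exists>vs. set vs \<subseteq> S' \<and> length vs = s \<and> P = wedge_list (map vec vs))"

text \<open>Reflexivity in finite dimension: a linear functional on \<open>S\<close> comes from an
  element of \<open>S'\<close>, whose coordinates are the values at the basis
  \<open>e\<close>.\<close>

lemma functional_representation:
  assumes "\<And>x y. x \<in> S \<Longrightarrow> y \<in> S \<Longrightarrow> f (x + y) = f x + f y"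
    and "\<And>c x. x \<in> S \<Longrightarrow> f (sc c x) = c * f x"
  obtains v where "v \<in> S'" "\<And>x. x \<in> S \<Longrightarrow> bil x v = f x"
proof
  let ?v = "\<Sum>i\<in>B. sc' (f (e i)) (e' i)"
  show "?v \<in> S'" by (intro Y.sum_mem Y.scale_mem e'_mem)
  fix x assume x: "x \<in> S"
  have f_sum: "sum g A \<in> S \<and> f (sum g A) = (\<Sum>i\<in>A. f (g i))"
    if "finite A" "\<And>i. i \<in> A \<Longrightarrow> g i \<in> S" for g and A :: "'i set"
    using that
  proof (induction A rule: finite_induct)
    case empty
    then show ?case using assms(1)[OF X.zero_mem X.zero_mem] by (simp add: X.zero_mem)
  qed (auto simp: X.add_mem assms(1))
  have "bil x ?v = (\<Sum>i\<in>B. bil x (sc' (f (e i)) (e' i)))"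
    by (rule bil_sum_right[OF finB x, THEN conjunct2]) (rule Y.scale_mem[OF e'_mem])
  also have "\<dots> = (\<Sum>i\<in>B. f (sc (bil x (e' i)) (e i)))"
    by (rule sum.cong[OF refl]) (simp add: bil_scale_right x e'_mem e_mem assms(2))
  also have "\<dots> = f (\<Sum>i\<in>B. sc (bil x (e' i)) (e i))"
    by (rule f_sum[OF finB, THEN conjunct2, symmetric]) (rule X.scale_mem[OF e_mem])
  also have "\<dots> = f x" by (simp only: expand[OF x, symmetric])
  finally show "bil x ?v = f x" .
qed

lemma decomp_0: "s \<ge> 1 \<Longrightarrow> decomp s 0"
proof -
  assume "s \<ge> 1"
  have "bil x 0 = 0" if "x \<in> S" for x
    using bil_add_right[OF that Y.zero_mem Y.zero_mem] by simp
  then have "vec 0 = 0" by (auto simp: vec_def fun_eq_iff split: list.splits)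
  then have "wedge_list (map vec (replicate s 0)) = 0" using \<open>s \<ge> 1\<close> by (cases s) auto
  then show ?thesis
    unfolding decomp_def by (intro exI[of _ "replicate s 0"]) (auto simp: Y.zero_mem)
qed

lemma decomp_if_three_term:
  assumes s: "s \<ge> 1" and P: "P \<in> X.alt (int s)" "three_term s P"
  shows "decomp s P"
proof (cases "P = 0")
  case True
  then show ?thesis using decomp_0 s by simp
next
  case False
  then obtain ys where ys: "P ys \<noteq> 0" by (auto simp: fun_eq_iff)
  then have len: "length ys = s" "set ys \<subseteq> S" using X.alt_off[OF P(1), of ys] by auto
  then obtain y zs where yz: "ys = y # zs" using s by (cases ys) auto
  \<comment> \<open>Rescaling one argument makes the value of \<open>P\<close> equal to 1, so that
    the \<open>u i\<close> below become dual to the \<open>\<alpha> i\<close>.\<close>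
  define xs where "xs = sc (1 / P ys) y # zs"
  have "P xs = 1"
    using X.alt_scale_at[OF P(1), of y "[]"] len yz ys by (simp add: xs_def)
  define \<alpha> where "\<alpha> i = xs ! i" for i
  have \<alpha>_xs: "map \<alpha> [0..<s] = xs"
  proof -
    have "length xs = s" using len yz by (simp add: xs_def)
    then show ?thesis using map_nth[of xs] by (simp add: \<alpha>_def[abs_def])
  qed
  have P_one: "P (map \<alpha> [0..<s]) = 1" using \<open>P xs = 1\<close> \<alpha>_xs by simp
  have "set xs \<subseteq> S" using len yz by (auto simp: xs_def X.scale_mem)
  then have \<alpha>: "\<alpha> i \<in> S" if "i < s" for i
    using that \<alpha>_xs nth_mem[of i xs] len yz by (auto simp: \<alpha>_def xs_def)
  define G where "G i x = P (map (\<alpha>(i := x)) [0..<s])" for i x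
  have "\<exists>v. v \<in> S' \<and> (\<forall>x\<in>S. bil x v = G i x)" if "i < s" for i
  proof -
    have m: "map (\<alpha>(i := z)) [0..<s] = map \<alpha> [0..<i] @ z # map \<alpha> [Suc i..<s]" for z
    proof -
      have "[0..<s] = [0..<i] @ i # [Suc i..<s]"
        using that by (metis less_imp_le_nat upt_conv_Cons upt_add_eq_append le_add_diff_inverse le0)
      then show ?thesis by simp
    qed
    show ?thesis
      using functional_representation[of "G i"] X.alt_add_at[OF P(1)] X.alt_scale_at[OF P(1)]
      unfolding G_def m by metis
  qed
  then obtain u where u: "\<And>i. i < s \<Longrightarrow> u i \<in> S'" "\<And>i x. i < s \<Longrightarrow> x \<in> S \<Longrightarrow> bil x (u i) = G i x"
    by metis
  have delta: "bil (\<alpha> i) (u j) = (if i = j then 1 else 0)" if "i < s" "j < s" for i j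
  proof (cases "i = j")
    case True
    then show ?thesis using P_one u \<alpha> that by (simp add: G_def)
  next
    case False
    then have "\<not> distinct (map (\<alpha>(j := \<alpha> i)) [0..<s])"
      using that inj_onD[of "\<alpha>(j := \<alpha> i)" "{0..<s}" i j] by (auto simp: distinct_map)
    then show ?thesis using u \<alpha> that False X.alt_not_distinct[OF P(1)] by (simp add: G_def)
  qed
  define W where "W = {w \<in> S. \<forall>i<s. P (map (\<alpha>(i := w)) [0..<s]) = 0}"
  define P' where "P' = wedge_list (map vec (map u [0..<s]))"
  have us: "set (map u [0..<s]) \<subseteq> S'" using u by auto
  have P': "P' \<in> X.alt (int s)"
    using wedge_list_vec_alt[OF us] by (simp add: P'_def)
  have "P - P' = 0"
  proof (rule X.alt_eq_0_if_spanning[where \<alpha> = \<alpha> and W = W])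
    show "P - P' \<in> X.alt (int s)" using P P' by (simp add: X.alt_diff)
    show "\<alpha> i \<in> S" if "i < s" for i using \<alpha> that .
    show "W \<subseteq> S" by (auto simp: W_def)
    fix x assume x: "x \<in> S"
    \<comment> \<open>The component of \<open>x\<close> in the span of the
      \<open>\<alpha> i\<close>. By duality \<open>x\<close> and \<open>v\<close> agree on every
      \<open>u j\<close>, so \<open>x - v\<close> lies in \<open>W\<close>.\<close>
    define v where "v = (\<Sum>i<s. sc (bil x (u i)) (\<alpha> i))"
    have v: "v \<in> S" "bil v (u j) = bil x (u j)" if "j < s" for j
    proof -
      have *: "v \<in> S \<and> bil v (u j) = (\<Sum>i<s. bil (sc (bil x (u i)) (\<alpha> i)) (u j))"
        unfolding v_def by (rule bil_sum_left) (use u \<alpha> that in \<open>auto simp: X.scale_mem\<close>)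
      also have "(\<Sum>i<s. bil (sc (bil x (u i)) (\<alpha> i)) (u j)) = (\<Sum>i<s. if i = j then bil x (u j) else 0)"
        using u \<alpha> that delta by (intro sum.cong) (auto simp: bil_scale_left)
      also have "\<dots> = bil x (u j)" using that by simp
      finally show "v \<in> S" "bil v (u j) = bil x (u j)" by auto
    qed
    have vS: "v \<in> S" using v(1) s by auto
    have "bil (x - v) (u j) = 0" if "j < s" for j
      using bil_add_left[OF X.diff_mem[OF x vS] vS u(1)[OF that]] v(2)[OF that] by simp
    then have "x - v \<in> W" using u X.diff_mem[OF x vS] by (auto simp: W_def G_def)
    then show "\<exists>c. \<exists>w\<in>W. x = (\<Sum>i<s. sc (c i) (\<alpha> i)) + w"
      by (intro exI[of _ "\<lambda>i. bil x (u i)"] bexI[of _ "x - v"]) (auto simp: v_def)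
  next
    fix f assume f: "\<And>i. i < s \<Longrightarrow> f i = \<alpha> i \<or> f i \<in> W"
    \<comment> \<open>The slots that differ from \<open>\<alpha>\<close>. If there are none, both
      functions take the value 1; otherwise \<open>P'\<close> vanishes because elements of
      \<open>W\<close> annihilate all its factors, and \<open>P\<close> by the three-term
      relations.\<close>
    define M where "M = {i. i < s \<and> f i \<noteq> \<alpha> i}"
    have fM: "map f [0..<s] = map (\<lambda>i. if i \<in> M then f i else \<alpha> i) [0..<s]"
      by (auto simp: M_def)
    have "P (map f [0..<s]) = P' (map f [0..<s])"
    proof (cases "M = {}")
      case True
      have "P' (map \<alpha> [0..<s]) = 1"
        unfolding P'_def
        by (rule wedge_list_dual)
          (use delta \<alpha> in auto)
      then show ?thesis using True P_one by (simp add: fM)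
    next
      case False
      then obtain i where i: "i < s" "f i \<in> W" using f by (auto simp: M_def)
      have "P' (map f [0..<s]) = 0"
        unfolding P'_def by (rule wedge_list_kill[of "f i"]) (use i u in \<open>auto simp: W_def G_def\<close>)
      moreover have "P (map f [0..<s]) = 0"
        unfolding fM by (rule X.three_term_vanish[OF P P_one \<alpha> _ False])
          (use f in \<open>auto simp: M_def W_def\<close>)
      ultimately show ?thesis by simp
    qed
    then show "(P - P') (map f [0..<s]) = 0" by simp
  qed
  then have "P = wedge_list (map vec (map u [0..<s]))" by (simp add: P'_def)
  then show ?thesis unfolding decomp_def using us by (intro exI[of _ "map u [0..<s]"]) auto
qed

lemma interiors_wedge_if_decomp:
  "decomp s P \<Longrightarrow> length \<gamma> < s \<Longrightarrow> interiors \<gamma> P \<and>\<^sub>e P = 0"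
  unfolding decomp_def using interiors_wedge_list vec_wedge_list by blast

lemma decomp_iff_three_term:
  assumes "s \<ge> 1" "P \<in> X.alt (int s)"
  shows "decomp s P \<longleftrightarrow> three_term s P"
  using decomp_if_three_term[OF assms] interiors_wedge_if_decomp
    X.three_term_if_plucker2[OF assms(2)] by fastforce

text \<open>Both equivalences pass through \<open>three_term\<close>. For \<open>s = 1\<close> the
  second condition is vacuous, in agreement with every 1-vector being decomposable.\<close>

lemma decomp_iff_plucker:
  assumes "s \<ge> 1" "P \<in> X.alt (int s)"
  shows "decomp s P \<longleftrightarrow> (\<forall>\<gamma>. length \<gamma> + 1 = s \<longrightarrow> interiors \<gamma> P \<and>\<^sub>e P = 0)"
    and "decomp s P \<longleftrightarrow> (\<forall>\<gamma>. length \<gamma> + 2 = s \<longrightarrow> interiors \<gamma> P \<and>\<^sub>e P = 0)"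
  using decomp_if_three_term[OF assms] interiors_wedge_if_decomp
    X.three_term_if_plucker1[OF assms(2)] X.three_term_if_plucker2[OF assms(2)]
  by (metis less_add_same_cancel1 less_one zero_less_numeral)+

end

subsection \<open>Pairing and contraction\<close>

lemma sum_fun_app: "(\<Sum>i\<in>A. F i) x = (\<Sum>i\<in>A. F i x)"
  by (induction A rule: infinite_finite_induct) auto

lemma interior_sum: "interior x (\<Sum>i\<in>A. F i) = (\<Sum>i\<in>A. interior x (F i))"
  by (rule ext) (simp add: interior_def sum_fun_app)

lemma smult_sum: "smult c (\<Sum>i\<in>A. F i) = (\<Sum>i\<in>A. smult c (F i))"
  by (rule ext) (simp add: sum_fun_app sum_distrib_left)

lemma sum_wedge: "(\<Sum>i\<in>A. F i) \<and>\<^sub>e G = (\<Sum>i\<in>A. F i \<and>\<^sub>e G)"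
  by (induction A rule: infinite_finite_induct) (simp_all only: simp_thms sum.infinite sum.empty sum.insert wedge_bilinear)

lemma (in lin_set) alt_sum: "(\<And>i. i \<in> A \<Longrightarrow> F i \<in> alt d) \<Longrightarrow> (\<Sum>i\<in>A. F i) \<in> alt d"
  by (induction A rule: infinite_finite_induct) (simp_all add: alt_0 alt_add)

context dual_pair begin

text \<open>Contraction over ordered tuples of basis elements, free of division so that it recurses
  through \<open>interior\<close>. For alternating arguments each set of \<open>n\<close> basis
  elements is counted \<open>fact n\<close> times, which \<open>cont\<close> corrects.\<close>

primrec contr :: "nat \<Rightarrow> ('a list \<Rightarrow> 'k) \<Rightarrow> ('b list \<Rightarrow> 'k) \<Rightarrow> 'a list \<Rightarrow> 'k" where
  "contr 0 P \<Phi> = smult (\<Phi> []) P"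
| "contr (Suc n) P \<Phi> = (\<Sum>i\<in>B. contr n (interior (e i) P) (interior (e' i) \<Phi>))"

lemma contr_add_left: "contr n (P + Q) \<Phi> = contr n P \<Phi> + contr n Q \<Phi>"
  by (induction n arbitrary: P Q \<Phi>) (simp_all only: contr.simps smult_add interior_simps sum.distrib)

lemma contr_smult_left: "contr n (smult c P) \<Phi> = smult c (contr n P \<Phi>)"
  by (induction n arbitrary: P \<Phi>)
    (simp_all only: contr.simps smult_simps interior_simps smult_sum mult.commute)

lemma contr_0_left: "contr n 0 \<Phi> = 0"
  using contr_smult_left[of n 0 0 \<Phi>] by (simp only: smult_simps)

lemma contr_minus_left: "contr n (- P) \<Phi> = - contr n P \<Phi>"
  using contr_add_left[of n P "- P" \<Phi>]
  by (simp only: right_minus contr_0_left eq_neg_iff_add_eq_0 add.commute)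

lemma contr_sum_left: "contr n (\<Sum>i\<in>A. P i) \<Phi> = (\<Sum>i\<in>A. contr n (P i) \<Phi>)"
  by (induction A rule: infinite_finite_induct)
    (simp_all only: simp_thms sum.infinite sum.empty sum.insert contr_0_left contr_add_left)

lemma contr_add_right: "contr n P (\<Phi> + \<Psi>) = contr n P \<Phi> + contr n P \<Psi>"
  by (induction n arbitrary: P \<Phi> \<Psi>)
    (simp_all only: contr.simps smult_add_left interior_simps sum.distrib plus_fun_apply)

lemma contr_smult_right: "contr n P (smult c \<Phi>) = smult c (contr n P \<Phi>)"
  by (induction n arbitrary: P \<Phi>) (simp_all only: contr.simps smult_simps interior_simps smult_sum)

lemma contr_0_right: "contr n P 0 = 0"
  using contr_smult_right[of n P 0 0] by (simp only: smult_simps)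

text \<open>Each of the \<open>p\<close> insertions made by \<open>contr\<close> anticommutes with
  \<open>interior x\<close>.\<close>

lemma contr_interior:
  "P \<in> X.alt d \<Longrightarrow> contr p (interior x P) \<Phi> = smult ((-1) ^ p) (interior x (contr p P \<Phi>))"
proof (induction p arbitrary: P d \<Phi>)
  case (Suc p)
  have "contr p (interior (e i) (interior x P)) (interior (e' i) \<Phi>)
      = smult ((-1) ^ Suc p) (interior x (contr p (interior (e i) P) (interior (e' i) \<Phi>)))" for i
  proof -
    have "contr p (interior (e i) (interior x P)) (interior (e' i) \<Phi>)
        = - contr p (interior x (interior (e i) P)) (interior (e' i) \<Phi>)"
      by (subst X.alt_interior_interior(2)[OF Suc.prems]) (rule contr_minus_left)
    also have "\<dots> = - smult ((-1) ^ p) (interior x (contr p (interior (e i) P) (interior (e' i) \<Phi>)))"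
      by (subst Suc.IH[OF X.alt_interior[OF Suc.prems]]) rule
    also have "\<dots> = smult ((-1) ^ Suc p) (interior x (contr p (interior (e i) P) (interior (e' i) \<Phi>)))"
      by (rule ext) (simp add: smult_def)
    finally show ?thesis .
  qed
  then show ?case by (simp only: contr.simps interior_sum smult_sum)
qed simp

lemma contr_alt: "P \<in> X.alt d \<Longrightarrow> contr p P \<Phi> \<in> X.alt (d - int p)"
proof (induction p arbitrary: P d \<Phi>)
  case (Suc p)
  have "contr p (interior (e i) P) (interior (e' i) \<Phi>) \<in> X.alt (d - int (Suc p))" for i
    using Suc.IH[OF X.alt_interior[OF Suc.prems]] by (simp add: algebra_simps)
  then show ?case by (simp only: contr.simps X.alt_sum)
qed (simp add: X.alt_smult)

lemma contr_wedge_eq_0: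
  "(\<And>\<gamma>. length \<gamma> = p \<Longrightarrow> interiors \<gamma> F \<and>\<^sub>e G = 0) \<Longrightarrow> contr p F \<Phi> \<and>\<^sub>e G = 0"
proof (induction p arbitrary: F \<Phi>)
  case 0
  have "F \<and>\<^sub>e G = 0" using 0[of "[]"] by (simp only: interiors_simps(1) list.size simp_thms)
  then show ?case by (simp only: contr.simps wedge_bilinear smult_simps(4))
next
  case (Suc p)
  have "contr p (interior (e i) F) (interior (e' i) \<Phi>) \<and>\<^sub>e G = 0" for i
  proof (rule Suc.IH)
    fix \<gamma> :: "'a list" assume "length \<gamma> = p"
    then show "interiors \<gamma> (interior (e i) F) \<and>\<^sub>e G = 0"
      using Suc.prems[of "e i # \<gamma>"] by (simp only: interiors_simps(2) length_Cons)
  qed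
  then show ?case by (simp only: contr.simps sum_wedge sum.neutral_const)
qed

text \<open>
  Up to normalisation this is the adjointness of \<open>i(\<Phi>)\<close> and \<open>\<Phi> \<and> _\<close>; it goes by Pascal's rule, the
  first basis vector of the contraction being absorbed by either \<open>\<Phi>\<close> or \<open>\<Theta>\<close>.
\<close>

lemma contr_wedge:
  "P \<in> X.alt d \<Longrightarrow> \<Phi> \<in> Y.alt (int p) \<Longrightarrow> \<Theta> \<in> Y.alt (int q) \<Longrightarrow>
    contr (p + q) P (\<Phi> \<and>\<^sub>e \<Theta>) = smult (of_nat ((p + q) choose p)) (contr q (contr p P \<Phi>) \<Theta>)"
proof (induction "p + q" arbitrary: p q P d \<Phi> \<Theta>)
  case 0
  then show ?case by (simp add: ac_simps)
next
  case (Suc n)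
  note P = Suc.prems(1) and \<Phi> = Suc.prems(2) and \<Theta> = Suc.prems(3)
  let ?C = "contr q (contr p P \<Phi>) \<Theta>"
  \<comment> \<open>The summands whose first basis vector is absorbed by \<open>\<Phi>\<close>. For
    \<open>p = 0\<close> the truncated \<open>p - 1\<close> would turn the binomial coefficient into
    1, so 0 is written explicitly.\<close>
  have 1: "(\<Sum>i\<in>B. contr n (interior (e i) P) (interior (e' i) \<Phi> \<and>\<^sub>e \<Theta>))
      = smult (if p = 0 then 0 else of_nat (n choose (p - 1))) ?C"
  proof (cases p)
    case 0
    then have "interior (e' i) \<Phi> = 0" for i using \<Phi> Y.alt_interior_deg0 by simp
    then show ?thesis using 0 by (simp only: wedge_bilinear contr_0_right sum.neutral_const smult_simps simp_thms if_True)
  next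
    case p: (Suc p')
    have n: "n = p' + q" using Suc.hyps(2) p by simp
    have \<Phi>': "interior (e' i) \<Phi> \<in> Y.alt (int p')" for i using Y.alt_interior[OF \<Phi>] p by simp
    have "contr n (interior (e i) P) (interior (e' i) \<Phi> \<and>\<^sub>e \<Theta>)
      = smult (of_nat (n choose p')) (contr q (contr p' (interior (e i) P) (interior (e' i) \<Phi>)) \<Theta>)" for i
      using Suc.hyps(1)[OF n X.alt_interior[OF P] \<Phi>' \<Theta>] n by simp
    then show ?thesis by (simp only: p contr.simps contr_sum_left smult_sum) simp
  qed
  have 2: "(\<Sum>i\<in>B. contr n (interior (e i) P) (twist \<Phi> \<and>\<^sub>e interior (e' i) \<Theta>))
      = smult (if q = 0 then 0 else of_nat (n choose p)) ?C"
  proof (cases q)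
    case 0
    then have "interior (e' i) \<Theta> = 0" for i using \<Theta> Y.alt_interior_deg0 by simp
    then show ?thesis using 0 by (simp only: wedge_bilinear contr_0_right sum.neutral_const smult_simps simp_thms if_True)
  next
    case q: (Suc q')
    have n: "n = p + q'" using Suc.hyps(2) q by simp
    have \<Theta>': "interior (e' i) \<Theta> \<in> Y.alt (int q')" for i using Y.alt_interior[OF \<Theta>] q by simp
    have "contr n (interior (e i) P) (twist \<Phi> \<and>\<^sub>e interior (e' i) \<Theta>)
      = smult (of_nat (n choose p)) (contr q' (interior (e i) (contr p P \<Phi>)) (interior (e' i) \<Theta>))" for i
    proof -
      have "contr n (interior (e i) P) (twist \<Phi> \<and>\<^sub>e interior (e' i) \<Theta>)
        = smult ((-1) ^ p) (contr n (interior (e i) P) (\<Phi> \<and>\<^sub>e interior (e' i) \<Theta>))"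
        by (simp only: Y.alt_twist[OF \<Phi>] wedge_bilinear contr_smult_right nat_int)
      also have "contr n (interior (e i) P) (\<Phi> \<and>\<^sub>e interior (e' i) \<Theta>)
        = smult (of_nat (n choose p)) (contr q' (contr p (interior (e i) P) \<Phi>) (interior (e' i) \<Theta>))"
        using Suc.hyps(1)[OF n X.alt_interior[OF P] \<Phi> \<Theta>'] n by simp
      \<comment> \<open>The sign of moving the insertion past \<open>p\<close> contractions cancels
        the sign from \<open>twist \<Phi>\<close>.\<close>
      also have "contr p (interior (e i) P) \<Phi> = smult ((-1) ^ p) (interior (e i) (contr p P \<Phi>))"
        by (rule contr_interior[OF P])
      moreover have "(-1) ^ p * (of_nat (n choose p) * (-1) ^ p) = (of_nat (n choose p) :: 'k)"
        by (cases "even p") auto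
      ultimately show ?thesis by (simp only: contr_smult_left smult_simps(3))
    qed
    then show ?thesis by (simp only: q contr.simps smult_sum) simp
  qed
  have "contr (p + q) P (\<Phi> \<and>\<^sub>e \<Theta>) = smult (if p = 0 then 0 else of_nat (n choose (p - 1))) ?C
      + smult (if q = 0 then 0 else of_nat (n choose p)) ?C"
    by (simp only: Suc.hyps(2)[symmetric] contr.simps interior_wedge contr_add_right sum.distrib 1 2)
  also have "\<dots> = smult (of_nat (Suc n choose p)) ?C"
  proof (cases p)
    case 0
    then show ?thesis using Suc.hyps(2) by (simp flip: smult_add_left)
  next
    case (Suc p')
    then show ?thesis using Suc.hyps(2) \<open>p = Suc p'\<close>
      by (cases "q = 0") (simp_all add: add.commute flip: smult_add_left)
  qed
  finally show ?case by (simp only: Suc.hyps(2))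
qed

section \<open>The duality pairing and its nondegeneracy\<close>

definition pair :: "('a list \<Rightarrow> 'k) \<Rightarrow> ('b list \<Rightarrow> 'k) \<Rightarrow> 'k" where
  "pair P \<Phi> = (\<Sum>bs | distinct bs \<and> set bs \<subseteq> B. P (map e bs) * \<Phi> (map e' bs) / fact (length bs))"

lemma contr_sum_lists:
  "contr n P \<Phi> xs = (\<Sum>bs | set bs \<subseteq> B \<and> length bs = n. P (map e bs @ xs) * \<Phi> (map e' bs))"
proof (induction n arbitrary: P \<Phi> xs)
  case 0
  have "{bs::'i list. set bs \<subseteq> B \<and> length bs = 0} = {[]}" by auto
  then show ?case by simp
next
  case (Suc n)
  have lists: "{bs. set bs \<subseteq> B \<and> length bs = Suc n}
      = (\<lambda>(b, bs). b # bs) ` (B \<times> {bs. set bs \<subseteq> B \<and> length bs = n})" (is "_ = _ ` (B \<times> ?L)")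
    by (auto simp: length_Suc_conv image_iff)
  have "contr (Suc n) P \<Phi> xs
      = (\<Sum>i\<in>B. \<Sum>bs\<in>?L. P (map e (i # bs) @ xs) * \<Phi> (map e' (i # bs)))"
    by (simp add: sum_fun_app Suc.IH interior_def)
  also have "\<dots> = (\<Sum>(i, bs)\<in>B \<times> ?L. P (map e (i # bs) @ xs) * \<Phi> (map e' (i # bs)))"
    by (rule sum.cartesian_product)
  also have "\<dots> = (\<Sum>bs | set bs \<subseteq> B \<and> length bs = Suc n. P (map e bs @ xs) * \<Phi> (map e' bs))"
    unfolding lists by (subst sum.reindex) (auto simp: inj_on_def intro!: sum.cong)
  finally show ?case .
qed

text \<open>Tuples with a repeated basis element contribute 0 because \<open>P\<close> is
  alternating, so the sum may run over all tuples of length \<open>n\<close>.\<close>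

lemma pair_eq_contr:
  assumes P: "P \<in> X.alt (int n)"
  shows "pair P \<Phi> = contr n P \<Phi> [] / fact n"
proof -
  let ?D = "{bs. set bs \<subseteq> B \<and> length bs = n \<and> distinct bs}"
  let ?f = "\<lambda>bs. P (map e bs) * \<Phi> (map e' bs)"
  have "P (map e bs) = 0" if "length bs \<noteq> n" for bs
    using that by (intro X.alt_off[OF P]) simp
  then have "pair P \<Phi> = (\<Sum>bs\<in>?D. ?f bs / fact (length bs))"
    unfolding pair_def
    by (intro sum.mono_neutral_right) (auto intro: finite_subset[OF _ finite_subset_distinct[OF finB]])
  also have "\<dots> = (\<Sum>bs\<in>?D. ?f bs) / fact n"
    by (simp add: sum_divide_distrib)
  also have "(\<Sum>bs\<in>?D. ?f bs) = (\<Sum>bs | set bs \<subseteq> B \<and> length bs = n. ?f bs)"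
    by (rule sum.mono_neutral_left)
      (auto simp: distinct_map finite_lists_length_eq[OF finB] intro!: X.alt_not_distinct[OF P])
  finally show ?thesis by (simp add: contr_sum_lists)
qed

lemma pair_diff_left: "pair (P - Q) \<Phi> = pair P \<Phi> - pair Q \<Phi>"
  by (simp add: pair_def algebra_simps diff_divide_distrib sum_subtractf)

lemma pair_smult_right: "pair P (smult c \<Phi>) = c * pair P \<Phi>"
  by (simp add: pair_def sum_distrib_left ac_simps)

lemma pair_smult_left: "pair (smult c P) \<Phi> = c * pair P \<Phi>"
  by (simp add: pair_def sum_distrib_left ac_simps)

lemma pair_zero [simp]: "pair 0 \<Phi> = 0" "pair P 0 = 0"
  by (simp_all add: pair_def)

lemma pair_flip: "dual_pair.pair B e' e \<Phi> P = pair P \<Phi>"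
  by (simp add: dual_pair.pair_def[OF flip] pair_def mult.commute)

definition cont :: "nat \<Rightarrow> ('b list \<Rightarrow> 'k) \<Rightarrow> ('a list \<Rightarrow> 'k) \<Rightarrow> 'a list \<Rightarrow> 'k" where
  "cont p \<Phi> P = smult (1 / fact p) (contr p P \<Phi>)"

lemma cont_alt: "P \<in> X.alt d \<Longrightarrow> cont p \<Phi> P \<in> X.alt (d - int p)"
  unfolding cont_def by (intro X.alt_smult contr_alt)

text \<open>The binomial coefficient in \<open>contr_wedge\<close>, divided by
  \<open>fact (p + q)\<close>, is the normalization of two successive contractions.\<close>

lemma pair_cont:
  assumes P: "P \<in> X.alt (int (p + q))" and "\<Phi> \<in> Y.alt (int p)" "\<Theta> \<in> Y.alt (int q)"
  shows "pair (cont p \<Phi> P) \<Theta> = pair P (\<Phi> \<and>\<^sub>e \<Theta>)"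
proof -
  have "cont p \<Phi> P \<in> X.alt (int q)" using cont_alt[OF P, of p] by simp
  then have "pair (cont p \<Phi> P) \<Theta> = contr q (contr p P \<Phi>) \<Theta> [] / (fact p * fact q)"
    by (simp add: pair_eq_contr cont_def contr_smult_left)
  moreover have "of_nat ((p + q) choose p) / fact (p + q) = 1 / (fact p * fact q :: 'k)"
    by (simp add: binomial_fact)
  moreover have "pair P (\<Phi> \<and>\<^sub>e \<Theta>)
      = of_nat ((p + q) choose p) / fact (p + q) * contr q (contr p P \<Phi>) \<Theta> []"
    by (simp add: pair_eq_contr[OF P] contr_wedge[OF assms])
  ultimately show ?thesis by simp
qed

definition covec :: "'a \<Rightarrow> 'b list \<Rightarrow> 'k" where
  "covec x = (\<lambda>vs. case vs of [v] \<Rightarrow> if v \<in> S' then bil x v else 0 | _ \<Rightarrow> 0)"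

lemma covec_eq: "covec x = dual_pair.vec S' (\<lambda>v x. bil x v) x"
  by (simp add: dual_pair.vec_def[OF flip] covec_def)

lemma covec_alt: "x \<in> S \<Longrightarrow> covec x \<in> Y.alt 1"
  unfolding covec_eq by (rule dual_pair.vec_alt[OF flip])

lemma wedge_list_covec_alt:
  "set xs \<subseteq> S \<Longrightarrow> wedge_list (map covec xs) \<in> Y.alt (int (length xs))"
  unfolding covec_eq[abs_def] by (rule dual_pair.wedge_list_vec_alt[OF flip])

text \<open>The expansion of \<open>x\<close> in the basis \<open>e\<close>, carried through
  linearity in the first argument.\<close>

lemma cont_covec:
  assumes P: "P \<in> X.alt d" and x: "x \<in> S"
  shows "cont 1 (covec x) P = interior x P"
proof
  fix xs
  have "cont 1 (covec x) P xs = (\<Sum>i\<in>B. bil x (e' i) * P (e i # xs))"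
    by (simp add: cont_def sum_fun_app interior_def covec_def e'_mem)
  also have "\<dots> = (\<Sum>i\<in>B. P ([] @ sc (bil x (e' i)) (e i) # xs))"
    by (intro sum.cong refl) (subst X.alt_scale_at[OF P], simp_all add: e_mem)
  also have "\<dots> = P ([] @ (\<Sum>i\<in>B. sc (bil x (e' i)) (e i)) # xs)"
    by (rule X.alt_sum_at[OF P finB, THEN conjunct2, symmetric]) (rule X.scale_mem[OF e_mem])
  also have "\<dots> = interior x P xs"
    by (simp only: expand[OF x, symmetric] interior_def append_Nil)
  finally show "cont 1 (covec x) P xs = interior x P xs" .
qed

lemma pair_covecs:
  "P \<in> X.alt (int (length xs + q)) \<Longrightarrow> set xs \<subseteq> S \<Longrightarrow> \<Theta> \<in> Y.alt (int q) \<Longrightarrow>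
    pair P (wedge_list (map covec xs) \<and>\<^sub>e \<Theta>) = pair (interiors xs P) \<Theta>"
proof (induction xs arbitrary: P)
  case (Cons x xs)
  let ?\<Psi> = "wedge_list (map covec xs) \<and>\<^sub>e \<Theta>"
  have \<Psi>: "?\<Psi> \<in> Y.alt (int (length xs + q))"
    using Y.alt_wedge[OF wedge_list_covec_alt Cons.prems(3), of xs] Cons.prems(2) by simp
  have P: "P \<in> X.alt (int (1 + (length xs + q)))" using Cons.prems(1) by simp
  have x: "x \<in> S" using Cons.prems(2) by simp
  have P': "interior x P \<in> X.alt (int (length xs + q))"
    using X.alt_interior[OF Cons.prems(1)] by simp
  have "pair P (wedge_list (map covec (x # xs)) \<and>\<^sub>e \<Theta>) = pair P (covec x \<and>\<^sub>e ?\<Psi>)"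
    by (simp only: list.map wedge_list_simps wedge_assoc)
  also have "\<dots> = pair (cont 1 (covec x) P) ?\<Psi>"
    by (rule pair_cont[OF P _ \<Psi>, symmetric]) (simp add: covec_alt x)
  also have "\<dots> = pair (interiors xs (interior x P)) \<Theta>"
    unfolding cont_covec[OF P x] by (rule Cons.IH[OF P' _ Cons.prems(3)]) (use Cons.prems(2) in simp)
  finally show ?case by (simp only: interiors_simps(2))
qed simp

text \<open>Pairing \<open>R\<close> with the wedge product of the covectors in \<open>xs\<close>
  returns the value \<open>R xs\<close>.\<close>

lemma pair_nondegenerate:
  assumes R: "R \<in> X.alt d" and 0: "\<And>\<Theta>. \<Theta> \<in> Y.alt d \<Longrightarrow> pair R \<Theta> = 0"
  shows "R = 0"
proof -
  have "R xs = 0" for xs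
  proof (cases "int (length xs) = d \<and> set xs \<subseteq> S")
    case True
    then have R': "R \<in> X.alt (int (length xs + 0))" using R by simp
    have unit: "wedge_unit \<in> Y.alt (int 0)"
      using dual_pair.wedge_unit_alt[OF flip] by simp
    have "interiors xs R \<in> X.alt (int 0)"
      using X.alt_interiors[OF R', of xs] by (simp only: add_0_right diff_self of_nat_0)
    then have "R xs = pair (interiors xs R) wedge_unit"
      using pair_eq_contr[of "interiors xs R" 0 wedge_unit] by simp
    also have "\<dots> = pair R (wedge_list (map covec xs) \<and>\<^sub>e wedge_unit)"
      by (rule pair_covecs[OF R' _ unit, symmetric]) (use True in simp)
    also have "\<dots> = 0" using 0 wedge_list_covec_alt[of xs] True by simp
    finally show ?thesis .
  next
    case False
    then show ?thesis using X.alt_off[OF R] by blast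
  qed
  then show ?thesis by (simp add: fun_eq_iff)
qed

section \<open>Contractions characterized by adjointness\<close>

definition contract :: "int \<Rightarrow> int \<Rightarrow> ('b list \<Rightarrow> 'k) \<Rightarrow> ('a list \<Rightarrow> 'k) \<Rightarrow> 'a list \<Rightarrow> 'k" where
  "contract p s \<Phi> P = (THE R. R \<in> X.alt (s - p) \<and>
     (\<forall>\<Theta>\<in>Y.alt (s - p). pair R \<Theta> = pair P (\<Phi> \<and>\<^sub>e \<Theta>)))"

definition contract_dual :: "int \<Rightarrow> int \<Rightarrow> ('a list \<Rightarrow> 'k) \<Rightarrow> ('b list \<Rightarrow> 'k) \<Rightarrow> 'b list \<Rightarrow> 'k" where
  "contract_dual s q P \<Psi> = (THE \<Omega>. \<Omega> \<in> Y.alt (q - s) \<and>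
     (\<forall>Q\<in>X.alt (q - s). pair Q \<Omega> = pair (P \<and>\<^sub>e Q) \<Psi>))"

text \<open>Nondegeneracy gives uniqueness, so a contraction is computed by exhibiting one element
  with the adjointness property.\<close>

lemma contract_eqI:
  assumes "R \<in> X.alt (s - p)" "\<And>\<Theta>. \<Theta> \<in> Y.alt (s - p) \<Longrightarrow> pair R \<Theta> = pair P (\<Phi> \<and>\<^sub>e \<Theta>)"
  shows "contract p s \<Phi> P = R"
  unfolding contract_def
proof (rule the_equality)
  fix Q assume Q: "Q \<in> X.alt (s - p) \<and> (\<forall>\<Theta>\<in>Y.alt (s - p). pair Q \<Theta> = pair P (\<Phi> \<and>\<^sub>e \<Theta>))"
  have "Q - R = 0"
    by (rule pair_nondegenerate[of _ "s - p"]) (use Q assms in \<open>simp_all add: X.alt_diff pair_diff_left\<close>)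
  then show "Q = R" by simp
qed (use assms in blast)

lemma contract_eq_cont:
  assumes "P \<in> X.alt (int (p + q))" "\<Phi> \<in> Y.alt (int p)"
  shows "contract (int p) (int (p + q)) \<Phi> P = cont p \<Phi> P"
  by (rule contract_eqI) (use assms cont_alt[OF assms(1), of p \<Phi>] pair_cont[OF assms] in simp_all)

text \<open>In each case \<open>\<Phi>\<close> or \<open>\<Theta>\<close> has negative degree and is
  0. This serves (4) and (5) for \<open>s = 1\<close>.\<close>

lemma contract_neg:
  assumes "s < p \<or> p < 0" "\<Phi> \<in> Y.alt p"
  shows "contract p s \<Phi> P = 0"
proof (rule contract_eqI)
  fix \<Theta> assume "\<Theta> \<in> Y.alt (s - p)"
  then have "\<Phi> = 0 \<or> \<Theta> = 0"
    using assms Y.alt_neg_degree[of p \<Phi>] Y.alt_neg_degree[of "s - p" \<Theta>] by auto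
  then show "pair 0 \<Theta> = pair P (\<Phi> \<and>\<^sub>e \<Theta>)" by auto
qed (rule X.alt_0)

lemma contract_covecs:
  assumes "P \<in> X.alt (int s)" "set xs \<subseteq> S" "length xs + q = s"
  shows "contract (int (length xs)) (int s) (wedge_list (map covec xs)) P = interiors xs P"
proof (rule contract_eqI)
  have eq: "int s - int (length xs) = int q" using assms(3) by simp
  show "interiors xs P \<in> X.alt (int s - int (length xs))" by (rule X.alt_interiors[OF assms(1)])
  fix \<Theta> assume "\<Theta> \<in> Y.alt (int s - int (length xs))"
  then show "pair (interiors xs P) \<Theta> = pair P (wedge_list (map covec xs) \<and>\<^sub>e \<Theta>)"
    unfolding eq using pair_covecs[of P xs q \<Theta>] assms by simp
qed

text \<open>\<open>contract_dual\<close> is \<open>contract\<close> with the two sides of the dual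
  pair exchanged.\<close>

lemma contract_dual_spec:
  assumes P: "P \<in> X.alt (int s)" and \<Psi>: "\<Psi> \<in> Y.alt (int (s + j))"
  shows "contract_dual (int s) (int (s + j)) P \<Psi> \<in> Y.alt (int j)"
    and "Q \<in> X.alt (int j) \<Longrightarrow>
      pair Q (contract_dual (int s) (int (s + j)) P \<Psi>) = pair (P \<and>\<^sub>e Q) \<Psi>"
proof -
  interpret F: dual_pair sc' S' sc S "\<lambda>v x. bil x v" B e' e by (rule flip)
  have "contract_dual (int s) (int (s + j)) P \<Psi> = F.contract (int s) (int (s + j)) P \<Psi>"
    unfolding contract_dual_def F.contract_def pair_flip ..
  also have "\<dots> = F.cont s P \<Psi>" by (rule F.contract_eq_cont[OF \<Psi> P])
  finally have eq: "contract_dual (int s) (int (s + j)) P \<Psi> = F.cont s P \<Psi>" .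
  show "contract_dual (int s) (int (s + j)) P \<Psi> \<in> Y.alt (int j)"
    unfolding eq using F.cont_alt[OF \<Psi>, of s] by simp
  show "pair Q (contract_dual (int s) (int (s + j)) P \<Psi>) = pair (P \<and>\<^sub>e Q) \<Psi>" if "Q \<in> X.alt (int j)"
    unfolding eq using F.pair_cont[OF \<Psi> P that] by (simp add: pair_flip)
qed

text \<open>In one direction \<open>\<Phi>\<close> is taken to be a wedge product of covectors. In
  the other, \<open>contr\<close> writes the contraction by any form as a combination of insertions
  of elements of the basis \<open>e\<close>.\<close>

lemma contract_wedge_iff:
  assumes P: "P \<in> X.alt (int s)" and s: "p + j = s"
  shows "(\<forall>\<Phi>\<in>Y.alt (int p). contract (int p) (int s) \<Phi> P \<and>\<^sub>e P = 0) \<longleftrightarrow>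
    (\<forall>\<gamma>. length \<gamma> + j = s \<longrightarrow> interiors \<gamma> P \<and>\<^sub>e P = 0)"
proof
  assume *: "\<forall>\<Phi>\<in>Y.alt (int p). contract (int p) (int s) \<Phi> P \<and>\<^sub>e P = 0"
  have "interiors \<gamma> P \<and>\<^sub>e P = 0" if len: "length \<gamma> + j = s" for \<gamma>
  proof (cases "set \<gamma> \<subseteq> S")
    case True
    have "length \<gamma> = p" using len s by simp
    then show ?thesis
      using * contract_covecs[OF P True len] wedge_list_covec_alt[OF True] by metis
  next
    case False
    then have "interiors \<gamma> P = 0"
      using X.alt_off[OF P, of "\<gamma> @ xs" for xs] by (simp add: interiors_def fun_eq_iff)
    then show ?thesis by (simp only: wedge_bilinear)
  qed
  then show "\<forall>\<gamma>. length \<gamma> + j = s \<longrightarrow> interiors \<gamma> P \<and>\<^sub>e P = 0" by blast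
next
  assume *: "\<forall>\<gamma>. length \<gamma> + j = s \<longrightarrow> interiors \<gamma> P \<and>\<^sub>e P = 0"
  have "contract (int p) (int s) \<Phi> P \<and>\<^sub>e P = 0" if "\<Phi> \<in> Y.alt (int p)" for \<Phi>
  proof -
    have "contr p P \<Phi> \<and>\<^sub>e P = 0"
      by (rule contr_wedge_eq_0) (use * s in blast)
    then have "cont p \<Phi> P \<and>\<^sub>e P = 0" by (simp only: cont_def wedge_bilinear smult_simps(4))
    then show ?thesis using contract_eq_cont[of P p j \<Phi>] P that s by simp
  qed
  then show "\<forall>\<Phi>\<in>Y.alt (int p). contract (int p) (int s) \<Phi> P \<and>\<^sub>e P = 0" by blast
qed

text \<open>
  Both sides say that \<open>\<langle>(i(\<Theta>)P) \<and> P, \<Psi>\<rangle>\<close> vanishes identically, because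
  \<open>\<langle>i(i\<^sub>P\<Psi>)P, \<Theta>\<rangle> = \<langle>P, i\<^sub>P\<Psi> \<and> \<Theta>\<rangle> = \<plusminus>\<langle>i(\<Theta>)P, i\<^sub>P\<Psi>\<rangle> = \<plusminus>\<langle>P \<and> i(\<Theta>)P, \<Psi>\<rangle>\<close>.
\<close>

lemma contract_contract_dual_iff:
  assumes P: "P \<in> X.alt (int s)" and s: "p + j = s"
  shows "(\<forall>\<Psi>\<in>Y.alt (int (s + j)).
      contract (int j) (int s) (contract_dual (int s) (int (s + j)) P \<Psi>) P = 0) \<longleftrightarrow>
    (\<forall>\<Theta>\<in>Y.alt (int p). contract (int p) (int s) \<Theta> P \<and>\<^sub>e P = 0)"
proof -
  have js: "j + p = s" using s by simp
  have Pj: "P \<in> X.alt (int (j + p))" and Pp: "P \<in> X.alt (int (p + j))"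
    using P s by (simp_all add: add.commute)
  have key: "\<exists>c. c \<noteq> 0 \<and> pair (contract (int j) (int s) (contract_dual (int s) (int (s + j)) P \<Psi>) P) \<Theta>
      = c * pair (contract (int p) (int s) \<Theta> P \<and>\<^sub>e P) \<Psi>"
    if \<Psi>: "\<Psi> \<in> Y.alt (int (s + j))" and \<Theta>: "\<Theta> \<in> Y.alt (int p)" for \<Psi> \<Theta>
  proof -
    let ?\<Omega> = "contract_dual (int s) (int (s + j)) P \<Psi>"
    note \<Omega> = contract_dual_spec[OF P \<Psi>]
    have c1: "contract (int j) (int s) ?\<Omega> P = cont j ?\<Omega> P"
      by (rule contract_eq_cont[OF Pj \<Omega>(1), unfolded js])
    have c2: "contract (int p) (int s) \<Theta> P = cont p \<Theta> P"
      using contract_eq_cont[OF Pp \<Theta>] s by simp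
    have mem: "cont p \<Theta> P \<in> X.alt (int j)" using cont_alt[OF Pp, of p \<Theta>] by simp
    have "pair (cont j ?\<Omega> P) \<Theta> = pair P (?\<Omega> \<and>\<^sub>e \<Theta>)" by (rule pair_cont[OF Pj \<Omega>(1) \<Theta>])
    also have "\<dots> = (-1) ^ (j * p) * pair P (\<Theta> \<and>\<^sub>e ?\<Omega>)"
      by (subst Y.alt_wedge_commute[OF \<Omega>(1) \<Theta>]) (simp only: pair_smult_right nat_int)
    also have "pair P (\<Theta> \<and>\<^sub>e ?\<Omega>) = pair (cont p \<Theta> P) ?\<Omega>" by (rule pair_cont[OF Pp \<Theta> \<Omega>(1), symmetric])
    also have "\<dots> = pair (P \<and>\<^sub>e cont p \<Theta> P) \<Psi>" by (rule \<Omega>(2)[OF mem])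
    also have "\<dots> = (-1) ^ (s * j) * pair (cont p \<Theta> P \<and>\<^sub>e P) \<Psi>"
      by (subst X.alt_wedge_commute[OF P mem]) (simp only: pair_smult_left nat_int)
    finally have "pair (cont j ?\<Omega> P) \<Theta> = ((-1) ^ (j * p) * (-1) ^ (s * j)) * pair (cont p \<Theta> P \<and>\<^sub>e P) \<Psi>"
      by (simp only: mult.assoc)
    then show ?thesis unfolding c1 c2 by (intro exI[of _ "(-1) ^ (j * p) * (-1) ^ (s * j)"] conjI) simp_all
  qed
  \<comment> \<open>By nondegeneracy this contraction is tested against all \<open>\<Theta>\<close>,
    and in \<open>R\<close> the wedge product against all \<open>\<Psi>\<close>; both conditions
    become the same double family of equations.\<close>
  have L: "contract (int j) (int s) (contract_dual (int s) (int (s + j)) P \<Psi>) P = 0 \<longleftrightarrow>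
      (\<forall>\<Theta>\<in>Y.alt (int p). pair (contract (int p) (int s) \<Theta> P \<and>\<^sub>e P) \<Psi> = 0)"
    if \<Psi>: "\<Psi> \<in> Y.alt (int (s + j))" for \<Psi>
  proof -
    let ?R = "contract (int j) (int s) (contract_dual (int s) (int (s + j)) P \<Psi>) P"
    have "?R \<in> X.alt (int p)"
      unfolding contract_eq_cont[OF Pj contract_dual_spec(1)[OF P \<Psi>], unfolded js]
      using cont_alt[OF Pj, of j] by simp
    then have "?R = 0 \<longleftrightarrow> (\<forall>\<Theta>\<in>Y.alt (int p). pair ?R \<Theta> = 0)"
      using pair_nondegenerate by (metis pair_zero(1))
    also have "\<dots> \<longleftrightarrow> (\<forall>\<Theta>\<in>Y.alt (int p). pair (contract (int p) (int s) \<Theta> P \<and>\<^sub>e P) \<Psi> = 0)"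
      using key[OF \<Psi>] by (metis mult_eq_0_iff)
    finally show ?thesis .
  qed
  have R: "contract (int p) (int s) \<Theta> P \<and>\<^sub>e P = 0 \<longleftrightarrow>
      (\<forall>\<Psi>\<in>Y.alt (int (s + j)). pair (contract (int p) (int s) \<Theta> P \<and>\<^sub>e P) \<Psi> = 0)"
    if \<Theta>: "\<Theta> \<in> Y.alt (int p)" for \<Theta>
  proof -
    have "contract (int p) (int s) \<Theta> P \<in> X.alt (int j)"
      unfolding contract_eq_cont[OF Pp \<Theta>, unfolded s] using cont_alt[OF Pp, of p \<Theta>] by simp
    then have "contract (int p) (int s) \<Theta> P \<and>\<^sub>e P \<in> X.alt (int (s + j))"
      using X.alt_wedge[OF _ P] by (simp add: add.commute)
    then show ?thesis using pair_nondegenerate by (metis pair_zero(1))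
  qed
  show ?thesis using L R by blast
qed

end

subsection \<open>Skew-symmetrization\<close>

text \<open>Antisymmetry is assumed for adjacent entries of distinct lists in \<open>U\<close>,
  since the lists will consist of positions, not of arguments.\<close>

lemma antisymmetric_move:
  fixes H :: "'b list \<Rightarrow> 'k::field"
  assumes anti: "\<And>ps a b qs. distinct (ps @ a # b # qs) \<Longrightarrow> set (ps @ a # b # qs) \<subseteq> U \<Longrightarrow>
    H (ps @ a # b # qs) = - H (ps @ b # a # qs)"
  shows "distinct (ps @ x # qs @ rs) \<Longrightarrow> set (ps @ x # qs @ rs) \<subseteq> U \<Longrightarrow>
    H (ps @ x # qs @ rs) = (-1) ^ length qs * H (ps @ qs @ x # rs)"
proof (induction qs arbitrary: ps)
  case (Cons q qs)
  have "H (ps @ x # q # qs @ rs) = - H (ps @ q # x # qs @ rs)"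
    using Cons.prems by (intro anti) auto
  also have "H (ps @ q # x # qs @ rs) = (-1) ^ length qs * H (ps @ q # qs @ x # rs)"
    using Cons.IH[of "ps @ [q]"] Cons.prems by auto
  finally show ?case by simp
qed simp

text \<open>The prefix \<open>ps\<close> holds the entries already in order. If the next entry
  belongs to the complement, it moves back over the \<open>card A'\<close> entries selected by
  \<open>A'\<close>, one sign for each inversion at position 0.\<close>

lemma antisymmetric_unshuffle:
  fixes H :: "'b list \<Rightarrow> 'k::field"
  assumes anti: "\<And>ps a b qs. distinct (ps @ a # b # qs) \<Longrightarrow> set (ps @ a # b # qs) \<subseteq> U \<Longrightarrow>
    H (ps @ a # b # qs) = - H (ps @ b # a # qs)"
  shows "A \<subseteq> {..<length js} \<Longrightarrow> distinct (ps @ js) \<Longrightarrow> set (ps @ js) \<subseteq> U \<Longrightarrow>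
    H (ps @ nths js A @ nths js ({..<length js} - A)) = (-1) ^ inversions (length js) A * H (ps @ js)"
proof (induction js arbitrary: ps A)
  case (Cons x js)
  let ?n = "length js"
  define A' where "A' = {j. Suc j \<in> A}"
  have A': "A' \<subseteq> {..<?n}" using Cons.prems(1) by (auto simp: A'_def)
  have IH: "H ((ps @ [x]) @ nths js A' @ nths js ({..<?n} - A'))
      = (-1) ^ inversions ?n A' * H ((ps @ [x]) @ js)"
    using Cons.prems by (intro Cons.IH A') auto
  show ?case
  proof (cases "0 \<in> A")
    case True
    have A: "A = insert 0 (Suc ` A')"
      unfolding A'_def using True by (auto simp: image_iff) (metis not0_implies_Suc)
    show ?thesis
      using IH unfolding A length_Cons nths_Cons_shift inversions_Suc(2)[OF A'] by simp
  next
    case False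
    have A: "A = Suc ` A'"
      unfolding A'_def using False by (auto simp: image_iff) (metis not0_implies_Suc)
    have js: "distinct js" using Cons.prems(2) by simp
    have "set (nths js A') \<inter> set (nths js ({..<?n} - A')) = {}"
      using nth_eq_iff_index_eq[OF js] by (auto simp: set_nths)
    moreover have "set (nths js A') \<subseteq> set js" "set (nths js ({..<?n} - A')) \<subseteq> set js"
      by (rule set_nths_subset)+
    ultimately have d: "distinct (ps @ x # nths js A' @ nths js ({..<?n} - A'))"
      "set (ps @ x # nths js A' @ nths js ({..<?n} - A')) \<subseteq> U"
      using Cons.prems(2,3) distinct_nthsI[OF js] by auto
    have "H (ps @ x # nths js A' @ nths js ({..<?n} - A'))
        = (-1) ^ card A' * H (ps @ nths js A' @ x # nths js ({..<?n} - A'))"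
      using antisymmetric_move[where H = H and U = U, OF anti d] length_nths_subset[OF A'] by simp
    then have "H (ps @ nths js A' @ x # nths js ({..<?n} - A'))
        = (-1) ^ card A' * H (ps @ x # nths js A' @ nths js ({..<?n} - A'))"
      by (simp flip: mult.assoc power_add mult_2)
    then show ?thesis
      using IH unfolding A length_Cons nths_Cons_shift inversions_Suc(1)[OF A']
      by (simp add: power_add)
  qed
qed simp

text \<open>
  The right-hand sum is antisymmetric in the arguments, so every shuffle in the wedge product
  contributes the same amount to the left-hand sum.
\<close>

lemma sum_permutations_wedge:
  fixes F G :: "'a list \<Rightarrow> 'k::field"
  assumes F: "\<And>zs. length zs \<noteq> p \<Longrightarrow> F zs = 0"
  shows "(\<Sum>\<pi> | \<pi> permutes {..<n}. of_int (sign \<pi>) * (F \<and>\<^sub>e G) (map (\<lambda>i. ys ! \<pi> i) [0..<n]))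
    = of_nat (n choose p) * (\<Sum>\<pi> | \<pi> permutes {..<n}. of_int (sign \<pi>) *
        (F (take p (map (\<lambda>i. ys ! \<pi> i) [0..<n])) * G (drop p (map (\<lambda>i. ys ! \<pi> i) [0..<n]))))"
proof -
  let ?\<Pi> = "{\<pi>. \<pi> permutes {..<n}}"
  define T where "T zs = F (take p zs) * G (drop p zs)" for zs
  \<comment> \<open>\<open>H\<close> depends on a list of positions. At \<open>[0..<n]\<close> it is
    the sum on the right, and exchanging two positions amounts to composing \<open>\<pi>\<close>
    with a transposition.\<close>
  define H where "H js = (\<Sum>\<pi>\<in>?\<Pi>. of_int (sign \<pi>) * T (map (\<lambda>i. ys ! \<pi> i) js))" for js
  have anti: "H (ps @ a # b # qs) = - H (ps @ b # a # qs)"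
    if d: "distinct (ps @ a # b # qs)" "set (ps @ a # b # qs) \<subseteq> {..<n}" for ps a b qs
  proof -
    let ?t = "Transposition.transpose a b"
    have t: "?t permutes {..<n}" using d by (intro permutes_swap_id) auto
    have sgn: "sign (\<pi> \<circ> ?t) = - sign \<pi>" if "\<pi> permutes {..<n}" for \<pi>
    proof -
      have "sign (\<pi> \<circ> ?t) = sign \<pi> * sign ?t"
        by (rule sign_compose)
          (use that t in \<open>auto intro: permutation_permutes[THEN iffD2] exI[of _ "{..<n}"]\<close>)
      then show ?thesis using d by (simp add: sign_swap_id)
    qed
    have js: "map (\<lambda>i. ys ! (\<pi> \<circ> ?t) i) (ps @ a # b # qs) = map (\<lambda>i. ys ! \<pi> i) (ps @ b # a # qs)" for \<pi>
      using d by (auto simp: Transposition.transpose_def)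
    have "H (ps @ a # b # qs)
      = (\<Sum>\<pi>\<in>?\<Pi>. of_int (sign (\<pi> \<circ> ?t)) * T (map (\<lambda>i. ys ! (\<pi> \<circ> ?t) i) (ps @ a # b # qs)))"
      unfolding H_def by (rule sum_permutations_compose_right[OF t])
    also have "\<dots> = - H (ps @ b # a # qs)"
      unfolding H_def js sum_negf[symmetric] by (intro sum.cong refl) (simp add: sgn)
    finally show ?thesis .
  qed
  have unshuffle: "H (nths [0..<n] A @ nths [0..<n] ({..<n} - A)) = (-1) ^ inversions n A * H [0..<n]"
    if "A \<subseteq> {..<n}" for A
    using antisymmetric_unshuffle[where H = H and U = "{..<n}" and ps = "[]" and js = "[0..<n]", OF anti] that
    by (simp add: atLeast0LessThan)
  have wedge: "(F \<and>\<^sub>e G) (map (\<lambda>i. ys ! \<pi> i) [0..<n]) = (\<Sum>A | A \<subseteq> {..<n} \<and> card A = p.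
      (-1) ^ inversions n A * T (map (\<lambda>i. ys ! \<pi> i) (nths [0..<n] A @ nths [0..<n] ({..<n} - A))))" for \<pi>
  proof -
    have "(F \<and>\<^sub>e G) (map (\<lambda>i. ys ! \<pi> i) [0..<n]) = (\<Sum>A\<in>Pow {..<n}. (-1) ^ inversions n A *
        F (map (\<lambda>i. ys ! \<pi> i) (nths [0..<n] A)) * G (map (\<lambda>i. ys ! \<pi> i) (nths [0..<n] ({..<n} - A))))"
      by (simp add: wedge_def nths_map)
    also have "\<dots> = (\<Sum>A | A \<subseteq> {..<n} \<and> card A = p. (-1) ^ inversions n A *
        F (map (\<lambda>i. ys ! \<pi> i) (nths [0..<n] A)) * G (map (\<lambda>i. ys ! \<pi> i) (nths [0..<n] ({..<n} - A))))"
      by (rule sum.mono_neutral_right) (auto simp: F length_nths_subset)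
    also have "\<dots> = (\<Sum>A | A \<subseteq> {..<n} \<and> card A = p.
      (-1) ^ inversions n A * T (map (\<lambda>i. ys ! \<pi> i) (nths [0..<n] A @ nths [0..<n] ({..<n} - A))))"
      by (intro sum.cong refl) (auto simp: T_def length_nths_subset)
    finally show ?thesis .
  qed
  have "(\<Sum>\<pi>\<in>?\<Pi>. of_int (sign \<pi>) * (F \<and>\<^sub>e G) (map (\<lambda>i. ys ! \<pi> i) [0..<n]))
    = (\<Sum>A | A \<subseteq> {..<n} \<and> card A = p. (-1) ^ inversions n A * H (nths [0..<n] A @ nths [0..<n] ({..<n} - A)))"
    unfolding wedge H_def sum_distrib_left by (subst sum.swap) (simp add: ac_simps)
  also have "\<dots> = (\<Sum>A | A \<subseteq> {..<n} \<and> card A = p. H [0..<n])"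
    by (intro sum.cong refl) (simp add: unshuffle flip: mult.assoc power_add mult_2)
  also have "\<dots> = of_nat (n choose p) * H [0..<n]"
    using n_subsets[of "{..<n}" p] by simp
  finally show ?thesis by (simp add: H_def T_def)
qed

context lin_set begin

lemma alt_move:
  "P \<in> alt d \<Longrightarrow> P (zs @ x # ys) = (-1) ^ length zs * P (x # zs @ ys)"
proof (induction zs arbitrary: P d)
  case (Cons z zs)
  have "P (z # zs @ x # ys) = (-1) ^ length zs * P (z # x # zs @ ys)"
    using Cons.IH[OF alt_interior[OF Cons.prems], of z] by (simp add: interior_def)
  also have "P (z # x # zs @ ys) = - P (x # z # zs @ ys)" by (rule alt_swap2[OF Cons.prems])
  finally show ?case by simp
qed simp

lemma alt_append_commute:
  "P \<in> alt d \<Longrightarrow> P (zs @ ys) = (-1) ^ (length zs * length ys) * P (ys @ zs)"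
proof (induction ys arbitrary: P d)
  case (Cons y ys)
  have "P (zs @ y # ys) = (-1) ^ length zs * P (y # zs @ ys)" by (rule alt_move[OF Cons.prems])
  also have "P (y # zs @ ys) = (-1) ^ (length zs * length ys) * P (y # ys @ zs)"
    using Cons.IH[OF alt_interior[OF Cons.prems], of y] by (simp add: interior_def)
  finally show ?case by (simp add: power_add)
qed simp

text \<open>\<open>\<gamma>\<close> fills the slots outside the skew-symmetrization. Moving it to
  the front of the second factor costs \<open>?\<epsilon>\<close>, exchanging the factors costs
  \<open>?\<delta>\<close>, and \<open>?n choose s\<close> counts the shuffles; these make up the
  constant.\<close>

lemma skew_tensor_eq:
  assumes P: "P \<in> alt (int s)" and "length ys = s + j" "length \<gamma> + j = s"
  shows "\<exists>c. c \<noteq> 0 \<and> skew (s + j) (tensor s P P) (ys @ \<gamma>) = c * (interiors \<gamma> P \<and>\<^sub>e P) ys"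
proof -
  let ?n = "s + j" and ?I = "interiors \<gamma> P"
  let ?\<epsilon> = "(-1) ^ (j * length \<gamma>) :: 'k" and ?\<delta> = "(-1) ^ (s * j) :: 'k"
  have "int s - int (length \<gamma>) = int j" using assms(3) by simp
  then have I: "?I \<in> alt (int j)" using alt_interiors[OF P, of \<gamma>] by (simp only:)
  have PI: "P \<and>\<^sub>e ?I \<in> alt (int ?n)" using alt_wedge[OF P I] by simp
  have G: "P (zs @ \<gamma>) = ?\<epsilon> * ?I zs" if "length zs = j" for zs
    using alt_append_commute[OF P, of zs \<gamma>] that by simp
  have map_app: "map (\<lambda>i. (ys @ \<gamma>) ! \<pi> i) [0..<length (ys @ \<gamma>)] = map (\<lambda>i. ys ! \<pi> i) [0..<?n] @ \<gamma>"
    if \<pi>: "\<pi> permutes {..<?n}" for \<pi>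
  proof (rule nth_equalityI)
    fix i assume "i < length (map (\<lambda>i. (ys @ \<gamma>) ! \<pi> i) [0..<length (ys @ \<gamma>)])"
    then have i: "i < length ys + length \<gamma>" by simp
    show "map (\<lambda>i. (ys @ \<gamma>) ! \<pi> i) [0..<length (ys @ \<gamma>)] ! i = (map (\<lambda>i. ys ! \<pi> i) [0..<?n] @ \<gamma>) ! i"
    proof (cases "i < ?n")
      case True
      then have "\<pi> i < ?n" using permutes_in_image[OF \<pi>, of i] by simp
      then show ?thesis using True i assms(2) by (simp add: nth_append)
    next
      case False
      then have "\<pi> i = i" using permutes_not_in[OF \<pi>, of i] by simp
      then show ?thesis using False i assms(2) by (simp add: nth_append)
    qed
  qed (use assms(2) in simp)
  have t: "tensor s P P (map (\<lambda>i. (ys @ \<gamma>) ! \<pi> i) [0..<length (ys @ \<gamma>)])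
      = ?\<epsilon> * (P (take s (map (\<lambda>i. ys ! \<pi> i) [0..<?n])) * ?I (drop s (map (\<lambda>i. ys ! \<pi> i) [0..<?n])))"
    if "\<pi> permutes {..<?n}" for \<pi>
    unfolding map_app[OF that] tensor_def take_append drop_append
    by (simp add: G del: interiors_simps)
  let ?R = "\<Sum>\<pi> | \<pi> permutes {..<?n}. of_int (sign \<pi>) *
      (P (take s (map (\<lambda>i. ys ! \<pi> i) [0..<?n])) * ?I (drop s (map (\<lambda>i. ys ! \<pi> i) [0..<?n])))"
  have "skew ?n (tensor s P P) (ys @ \<gamma>) = ?\<epsilon> * ?R / fact ?n"
    unfolding skew_def sum_distrib_left
    by (intro arg_cong[of _ _ "\<lambda>x. x / fact ?n"] sum.cong refl)
      (simp only: t mem_Collect_eq mult.left_commute)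
  moreover have "of_nat (?n choose s) * ?R = fact ?n * (?\<delta> * (?I \<and>\<^sub>e P) ys)"
  proof -
    have "of_nat (?n choose s) * ?R
      = (\<Sum>\<pi> | \<pi> permutes {..<?n}. of_int (sign \<pi>) * (P \<and>\<^sub>e ?I) (map (\<lambda>i. ys ! \<pi> i) [0..<?n]))"
      by (rule sum_permutations_wedge[symmetric]) (rule alt_off[OF P], simp)
    \<comment> \<open>\<open>P \<and>\<^sub>e ?I\<close> is alternating, so its sign cancels that of
      \<open>\<pi>\<close> and all permutations contribute equally.\<close>
    also have "\<dots> = (\<Sum>\<pi> | \<pi> permutes {..<?n}. (P \<and>\<^sub>e ?I) ys)"
    proof (rule sum.cong[OF refl])
      fix \<pi> assume "\<pi> \<in> {\<pi>. \<pi> permutes {..<?n}}"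
      then have "(P \<and>\<^sub>e ?I) (map (\<lambda>i. ys ! \<pi> i) [0..<?n]) = of_int (sign \<pi>) * (P \<and>\<^sub>e ?I) ys"
        using alt_permute[OF PI _ assms(2), of \<pi>] by simp
      then show "of_int (sign \<pi>) * (P \<and>\<^sub>e ?I) (map (\<lambda>i. ys ! \<pi> i) [0..<?n]) = (P \<and>\<^sub>e ?I) ys"
        by (simp add: sign_def)
    qed
    also have "\<dots> = fact ?n * (P \<and>\<^sub>e ?I) ys"
      using card_permutations[of "{..<?n}" ?n] by simp
    also have "(P \<and>\<^sub>e ?I) ys = ?\<delta> * (?I \<and>\<^sub>e P) ys"
      by (subst alt_wedge_commute[OF P I]) (simp only: smult_simps(1) nat_int)
    finally show ?thesis .
  qed
  moreover have "of_nat (?n choose s) \<noteq> (0::'k)" by simp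
  moreover have "x = (\<epsilon> * \<delta> / c) * y" if "x = \<epsilon> * r / f" "c * r = f * (\<delta> * y)" "c \<noteq> 0" "f \<noteq> 0"
    for x \<epsilon> \<delta> c y r f :: 'k
  proof -
    have "r = f * (\<delta> * y) / c" using that by (simp add: field_simps)
    then show ?thesis using that by simp
  qed
  ultimately have "skew ?n (tensor s P P) (ys @ \<gamma>) = (?\<epsilon> * ?\<delta> / of_nat (?n choose s)) * (?I \<and>\<^sub>e P) ys"
    using fact_nonzero by blast
  then show ?thesis by (intro exI[of _ "?\<epsilon> * ?\<delta> / of_nat (?n choose s)"]) simp
qed

lemma skew_tensor_iff:
  assumes P: "P \<in> alt (int s)" and j: "j \<le> s"
  shows "skew (s + j) (tensor s P P) = 0 \<longleftrightarrow> (\<forall>\<gamma>. length \<gamma> + j = s \<longrightarrow> interiors \<gamma> P \<and>\<^sub>e P = 0)"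
proof
  assume *: "skew (s + j) (tensor s P P) = 0"
  have "(interiors \<gamma> P \<and>\<^sub>e P) ys = 0" if len: "length \<gamma> + j = s" for \<gamma> ys
  proof (cases "length ys = s + j")
    case True
    then show ?thesis using skew_tensor_eq[OF P True len] * by auto
  next
    case False
    have "interiors \<gamma> P \<and>\<^sub>e P \<in> alt (int s - int (length \<gamma>) + int s)"
      by (rule alt_wedge[OF alt_interiors[OF P] P])
    then show ?thesis by (rule alt_off) (use False len in auto)
  qed
  then show "\<forall>\<gamma>. length \<gamma> + j = s \<longrightarrow> interiors \<gamma> P \<and>\<^sub>e P = 0" by (simp add: fun_eq_iff)
next
  assume *: "\<forall>\<gamma>. length \<gamma> + j = s \<longrightarrow> interiors \<gamma> P \<and>\<^sub>e P = 0"
  have "skew (s + j) (tensor s P P) xs = 0" for xs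
  proof (cases "length xs = 2 * s")
    case True
    let ?ys = "take (s + j) xs" and ?\<gamma> = "drop (s + j) xs"
    have len: "length ?ys = s + j" "length ?\<gamma> + j = s" using True j by auto
    have "(interiors ?\<gamma> P \<and>\<^sub>e P) ?ys = 0" using * len(2) by simp
    then show ?thesis using skew_tensor_eq[OF P len] by auto
  next
    case False
    have "tensor s P P zs = 0" if "length zs = length xs" for zs
    proof -
      \<comment> \<open>When the total length is not \<open>2 * s\<close>, one of the two factors
        receives a wrong number of arguments.\<close>
      have "length (take s zs) \<noteq> s \<or> length (drop s zs) \<noteq> s" using that False by auto
      then show ?thesis using alt_off[OF P, of "take s zs"] alt_off[OF P, of "drop s zs"]
        by (auto simp: tensor_def)
    qed
    then show ?thesis by (simp add: skew_def)
  qed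
  then show "skew (s + j) (tensor s P P) = 0" by (simp add: fun_eq_iff)
qed

end

subsection \<open>Characterizations of decomposable multivectors\<close>

lemma dual_space_iff:
  assumes "vector_space scale"
  shows "\<alpha> \<in> dual_space scale \<longleftrightarrow>
    (\<forall>x y. \<alpha> (x + y) = \<alpha> x + \<alpha> y) \<and> (\<forall>c x. \<alpha> (scale c x) = c * \<alpha> x)"
proof -
  have "vector_space ((*) :: 'a \<Rightarrow> 'a \<Rightarrow> 'a)"
    by unfold_locales (auto simp: algebra_simps)
  then show ?thesis using assms by (simp add: dual_space_def Vector_Spaces.linear_iff)
qed

text \<open>Covectors form the first side because multivectors are functions of covectors; the basis
  there consists of the coordinate functionals of \<open>B\<close>.\<close>

lemma dual_pair_dual_space:
  fixes scale :: "'k::field_char_0 \<Rightarrow> 'v::ab_group_add \<Rightarrow> 'v"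
  assumes "finite_dimensional_vector_space scale B"
  shows "dual_pair (\<lambda>c \<alpha> v. c * \<alpha> v) (dual_space scale) scale UNIV (\<lambda>\<alpha> v. \<alpha> v) B
    (\<lambda>b v. module.representation scale B v b) (\<lambda>b. b)"
proof -
  interpret V: finite_dimensional_vector_space scale B by fact
  note D = dual_space_iff[OF V.vector_space_axioms]
  have expand: "(\<Sum>b\<in>B. scale (V.representation B v b) b) = v" for v
    by (rule V.sum_representation_eq)
      (simp_all add: V.independent_Basis V.span_Basis V.finite_Basis)
  have B_eq: "V.representation B b b' = (if b' = b then 1 else 0)" if "b \<in> B" for b b'
    using V.representation_basis[OF V.independent_Basis that] by simp
  have rep: "(\<lambda>v. V.representation B v b) \<in> dual_space scale" for b
    by (simp add: D V.representation_add V.representation_scale V.independent_Basis V.span_Basis)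
  show ?thesis
  proof unfold_locales
    fix \<alpha> assume \<alpha>: "\<alpha> \<in> dual_space scale"
    have sum: "\<alpha> (sum f A) = (\<Sum>i\<in>A. \<alpha> (f i))" if "finite A" for f and A :: "'v set"
      using that
    proof (induction A rule: finite_induct)
      case empty
      have "\<alpha> (0 + 0) = \<alpha> 0 + \<alpha> 0" using \<alpha> D by blast
      then show ?case by simp
    qed (use \<alpha> D in auto)
    show "\<alpha> = (\<Sum>b\<in>B. (\<lambda>v. \<alpha> b * V.representation B v b))"
    proof
      fix v
      have "\<alpha> v = \<alpha> (\<Sum>b\<in>B. scale (V.representation B v b) b)" by (simp only: expand)
      also have "\<dots> = (\<Sum>b\<in>B. \<alpha> b * V.representation B v b)"
        using \<alpha> D by (simp add: sum[OF V.finite_Basis] mult.commute)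
      finally show "\<alpha> v = (\<Sum>b\<in>B. (\<lambda>v. \<alpha> b * V.representation B v b)) v"
        by (simp only: sum_fun_app)
    qed
  qed (auto simp: D expand V.finite_Basis algebra_simps rep[unfolded D])
qed

theorem theorem1:
  fixes scale :: "'k::field_char_0 \<Rightarrow> 'v::ab_group_add \<Rightarrow> 'v"
    and B :: "'v set"
    and s :: nat
    and P :: "('v \<Rightarrow> 'k) list \<Rightarrow> 'k"
  assumes "finite_dimensional_vector_space scale B"
    and "s \<ge> 1"
    and "P \<in> multivectors scale (int s)"
  shows
    "(decomposable scale s P \<longleftrightarrow>
       (\<forall>\<Phi>\<in>forms scale (int s - 1). contract_vec scale B (int s - 1) (int s) \<Phi> P \<and>\<^sub>e P = 0)) \<and>
     (decomposable scale s P \<longleftrightarrow> skew (s + 1) (tensor s P P) = 0) \<and>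
     (decomposable scale s P \<longleftrightarrow>
       (\<forall>\<Psi>\<in>forms scale (int s + 1).
          contract_vec scale B 1 (int s) (contract_form scale B (int s) (int s + 1) P \<Psi>) P = 0)) \<and>
     (\<forall>k. 2 \<le> k \<and> k \<le> s \<longrightarrow>
       (decomposable scale s P \<longleftrightarrow>
         (\<forall>\<alpha>s. length \<alpha>s = s - k \<and> set \<alpha>s \<subseteq> dual_space scale \<longrightarrow>
            decomposable scale k
              (contract_vec scale B (int (s - k)) (int s) (wedge_list (map of_covector \<alpha>s)) P)))) \<and>
     (decomposable scale s P \<longleftrightarrow>
       (\<forall>\<Psi>\<in>forms scale (int s - 2). contract_vec scale B (int s - 2) (int s) \<Psi> P \<and>\<^sub>e P = 0)) \<and>
     (s \<ge> 2 \<longrightarrow> (decomposable scale s P \<longleftrightarrow> skew (s + 2) (tensor s P P) = 0)) \<and>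
     (decomposable scale s P \<longleftrightarrow>
       (\<forall>\<Psi>\<in>forms scale (int s + 2).
          contract_vec scale B 2 (int s) (contract_form scale B (int s) (int s + 2) P \<Psi>) P = 0))"
proof -
  let ?dual = "dual_space scale"
  interpret D: dual_pair "\<lambda>c \<alpha> v. c * \<alpha> v" ?dual scale UNIV "\<lambda>\<alpha> v. \<alpha> v" B
    "\<lambda>b v. module.representation scale B v b" "\<lambda>b. b"
    by (rule dual_pair_dual_space[OF assms(1)])
  have mv: "multivectors scale = D.X.alt" by (simp add: multivectors_def fun_eq_iff)
  have fm: "forms scale = D.Y.alt" by (simp add: forms_def fun_eq_iff)
  have P: "P \<in> D.X.alt (int s)" using assms(3) by (simp add: mv)
  have pair: "pairing scale B = D.pair" by (simp add: pairing_def D.pair_def fun_eq_iff)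
  have cv: "contract_vec scale B = D.contract"
    by (simp add: contract_vec_def D.contract_def fun_eq_iff mv fm pair)
  have cf: "contract_form scale B = D.contract_dual"
    by (simp add: contract_form_def D.contract_dual_def fun_eq_iff mv fm pair)
  have dec: "decomposable scale = D.decomp"
    by (simp add: decomposable_def D.decomp_def fun_eq_iff of_vector_def[abs_def] D.vec_def[abs_def])
  have cov: "of_covector = D.covec"
    by (simp add: of_covector_def D.covec_def fun_eq_iff split: list.split)
  let ?plucker = "\<lambda>j. \<forall>\<gamma>. length \<gamma> + j = s \<longrightarrow> interiors \<gamma> P \<and>\<^sub>e P = 0"
  have 0: "D.decomp s P \<longleftrightarrow> ?plucker 1" "D.decomp s P \<longleftrightarrow> ?plucker 2"
    by (rule D.decomp_iff_plucker[OF assms(2) P])+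
  have wedge: "(\<forall>\<Phi>\<in>D.Y.alt (int s - int j). D.contract (int s - int j) (int s) \<Phi> P \<and>\<^sub>e P = 0)
      \<longleftrightarrow> ?plucker j" if "j \<le> s" for j
    using D.contract_wedge_iff[OF P, of "s - j" j] that by (simp only: of_nat_diff le_add_diff_inverse2)
  have dual: "(\<forall>\<Psi>\<in>D.Y.alt (int s + int j).
        D.contract (int j) (int s) (D.contract_dual (int s) (int s + int j) P \<Psi>) P = 0)
      \<longleftrightarrow> ?plucker j" if "j \<le> s" for j
    using D.contract_contract_dual_iff[OF P, of "s - j" j] D.contract_wedge_iff[OF P, of "s - j" j] that
    by (simp only: of_nat_add le_add_diff_inverse2)
  have 1: "D.decomp s P \<longleftrightarrow>
      (\<forall>\<Phi>\<in>D.Y.alt (int s - 1). D.contract (int s - 1) (int s) \<Phi> P \<and>\<^sub>e P = 0)"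
    using 0(1) wedge[of 1] assms(2) by (simp only: of_nat_1)
  have skew1: "D.decomp s P \<longleftrightarrow> skew (s + 1) (tensor s P P) = 0"
    using 0(1) D.X.skew_tensor_iff[OF P assms(2)] by simp
  have 2: "D.decomp s P \<longleftrightarrow> (\<forall>\<Psi>\<in>D.Y.alt (int s + 1).
      D.contract 1 (int s) (D.contract_dual (int s) (int s + 1) P \<Psi>) P = 0)"
    using 0(1) dual[of 1] assms(2) by (simp only: of_nat_1)
  have 3: "D.decomp s P \<longleftrightarrow> (\<forall>\<alpha>s. length \<alpha>s = s - k \<and> set \<alpha>s \<subseteq> ?dual \<longrightarrow>
      D.decomp k (D.contract (int (s - k)) (int s) (wedge_list (map D.covec \<alpha>s)) P))"
    if k: "2 \<le> k" "k \<le> s" for k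
  proof -
    have "D.decomp s P \<longleftrightarrow> (\<forall>\<gamma>. length \<gamma> + k = s \<longrightarrow> three_term k (interiors \<gamma> P))"
      unfolding three_term_interiors[OF k] by (rule D.decomp_iff_three_term[OF assms(2) P])
    also have "\<dots> \<longleftrightarrow> (\<forall>\<gamma>. length \<gamma> = s - k \<and> set \<gamma> \<subseteq> ?dual \<longrightarrow> three_term k (interiors \<gamma> P))"
    proof -
      \<comment> \<open>An entry of \<open>\<gamma>\<close> outside the dual space makes
        \<open>interiors \<gamma> P\<close> zero, so nothing is lost by restricting to
        covectors.\<close>
      have "three_term k (interiors \<gamma> P)" if "\<not> set \<gamma> \<subseteq> ?dual" for \<gamma>
        using D.X.alt_off[OF P, of "\<gamma> @ xs" for xs] that by (simp add: three_term_def)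
      moreover have "length \<gamma> + k = s \<longleftrightarrow> length \<gamma> = s - k" for \<gamma> :: "('v \<Rightarrow> 'k) list"
        using k by auto
      ultimately show ?thesis by blast
    qed
    also have "\<dots> \<longleftrightarrow> (\<forall>\<alpha>s. length \<alpha>s = s - k \<and> set \<alpha>s \<subseteq> ?dual \<longrightarrow>
      D.decomp k (D.contract (int (s - k)) (int s) (wedge_list (map D.covec \<alpha>s)) P))"
    proof (intro all_cong)
      fix \<gamma> assume \<gamma>: "length \<gamma> = s - k \<and> set \<gamma> \<subseteq> ?dual"
      then have "int s - int (length \<gamma>) = int k" using k by simp
      then have mem: "interiors \<gamma> P \<in> D.X.alt (int k)"
        using D.X.alt_interiors[OF P, of \<gamma>] by (simp only:)
      have "D.contract (int (s - k)) (int s) (wedge_list (map D.covec \<gamma>)) P = interiors \<gamma> P"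
        using D.contract_covecs[OF P, of \<gamma> k] \<gamma> k by simp
      then show "three_term k (interiors \<gamma> P) \<longleftrightarrow>
          D.decomp k (D.contract (int (s - k)) (int s) (wedge_list (map D.covec \<gamma>)) P)"
        using D.decomp_iff_three_term[OF _ mem] k by simp
    qed
    finally show ?thesis .
  qed
  have 45: "D.decomp s P \<longleftrightarrow>
      (\<forall>\<Psi>\<in>D.Y.alt (int s - 2). D.contract (int s - 2) (int s) \<Psi> P \<and>\<^sub>e P = 0)"
    "D.decomp s P \<longleftrightarrow> (\<forall>\<Psi>\<in>D.Y.alt (int s + 2).
      D.contract 2 (int s) (D.contract_dual (int s) (int s + 2) P \<Psi>) P = 0)"
  proof (atomize (full), cases "s \<ge> 2")
    case True
    then show "(D.decomp s P \<longleftrightarrow>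
        (\<forall>\<Psi>\<in>D.Y.alt (int s - 2). D.contract (int s - 2) (int s) \<Psi> P \<and>\<^sub>e P = 0)) \<and>
      (D.decomp s P \<longleftrightarrow> (\<forall>\<Psi>\<in>D.Y.alt (int s + 2).
        D.contract 2 (int s) (D.contract_dual (int s) (int s + 2) P \<Psi>) P = 0))"
      using 0(2) wedge[of 2] dual[of 2] by (simp only: of_nat_numeral)
  next
    case False
    \<comment> \<open>Here \<open>s = 1\<close> and \<open>P\<close> is decomposable. In (4) the
      form has negative degree, and in (5) the outer contraction lands in degree -1, so both
      conditions hold as well.\<close>
    then have s: "int s < 2" by simp
    have "D.decomp s P" using 0(2) False by auto
    moreover have "D.contract (int s - 2) (int s) \<Psi> P \<and>\<^sub>e P = 0" if "\<Psi> \<in> D.Y.alt (int s - 2)" for \<Psi>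
      using D.contract_neg[OF _ that] s by simp
    moreover have "D.contract 2 (int s) (D.contract_dual (int s) (int s + 2) P \<Psi>) P = 0"
      if "\<Psi> \<in> D.Y.alt (int s + 2)" for \<Psi>
      using D.contract_neg[of "int s" 2] s D.contract_dual_spec(1)[OF P, of \<Psi> 2] that
      by (simp only: of_nat_add of_nat_numeral simp_thms)
    ultimately show "(D.decomp s P \<longleftrightarrow>
        (\<forall>\<Psi>\<in>D.Y.alt (int s - 2). D.contract (int s - 2) (int s) \<Psi> P \<and>\<^sub>e P = 0)) \<and>
      (D.decomp s P \<longleftrightarrow> (\<forall>\<Psi>\<in>D.Y.alt (int s + 2).
        D.contract 2 (int s) (D.contract_dual (int s) (int s + 2) P \<Psi>) P = 0))"
      by blast
  qed
  have skew2: "s \<ge> 2 \<longrightarrow> (D.decomp s P \<longleftrightarrow> skew (s + 2) (tensor s P P) = 0)"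
    using 0(2) D.X.skew_tensor_iff[OF P, of 2] by blast
  show ?thesis
    unfolding fm cv cf dec cov using 1 skew1 2 3 45 skew2 by blast
qed

end
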